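(* Let $0\le\epsilon<I(X;Y)$. For every discrete random variable $U$, jointly distributed with $(X,Y)$ through a conditional distribution $P_{U|Y,X}$ satisfying $I(X;U)\le\epsilon$, there exists a random variable $U^*=(U_1^*,\dots,U_N^* )$, jointly distributed with $(X,Y)$, whose conditional distribution given $Y$ factorizes as $P_{U^*|Y}(u^*|y)=\prod_{i=1}^N P_{U_i^*|Y_i}(u_i^*|y_i)$, such that $$I(X;U^* )=I(X;U),$$ and for all $k\in\{1,\dots,K\}$ $$I(C_k;U)\le I(C_k;U^* )+\min\{\Delta_k^1,\Delta_k^2\},$$ where $$\Delta_k^1=I(X;C_k)+\sum_{j\in S_k}H(X_j|Y_j)=\sum_{j\in S_k}\big(I(X_j;Y_j)+H(X_j|Y_j)\big),$$ $$\Delta_k^2=I(X;C_k)+\sum_{j\in S_k}\big(\log(I(X_j;Y_j)+1)+4\big)=\sum_{j\in S_k}\big(I(X_j;Y_j)+\log(I(X_j;Y_j)+1)+4\big).$$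
   Context: $N,K\ge 1$ are integers. $X=(X_1,\dots,X_N)$ (private data) and $Y=(Y_1,\dots,Y_N)$ (useful data) are vectors of discrete random variables on finite alphabets. The pairs $(X_i,Y_i)$, $i=1,\dots,N$, are mutually independent, i.e. $P_{XY}(x,y)=\prod_{i=1}^N P_{X_i,Y_i}(x_i,y_i)$, while $X_i$ and $Y_i$ are arbitrarily correlated. For each user $k\in\{1,\dots,K\}$, $C_k$ is an arbitrary sub-vector of $Y$: $C_k=(Y_j)_{j\in S_k}$ for a subset $S_k\subseteq\{1,\dots,N\}$. $H$ and $I$ denote Shannon entropy and mutual information, measured in nats, and $\log$ is the natural logarithm. *)

theory Defs
  imports "HOL-Probability.Probability"
begin

text \<open>
  The base \<open>exp 1\<close> gives entropies in nats. The library's mutual information is a Bochner integral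
  and would be 0 in the non-integrable case; this cannot happen below, since in every use at least
  one argument takes values in a finite type and the other in a countable one.
\<close>

definition mutual_info :: "'w pmf \<Rightarrow> ('w \<Rightarrow> 'a) \<Rightarrow> ('w \<Rightarrow> 'b) \<Rightarrow> real" where
  "mutual_info p A B =
     prob_space.mutual_information (measure_pmf p) (exp 1) (count_space UNIV) (count_space UNIV) A B"

definition cond_ent :: "'w pmf \<Rightarrow> ('w \<Rightarrow> 'a) \<Rightarrow> ('w \<Rightarrow> 'b) \<Rightarrow> real" where
  "cond_ent p A B =
     prob_space.conditional_entropy (measure_pmf p) (exp 1) (count_space UNIV) (count_space UNIV) A B"

text \<open>
  The index set of the \<open>N\<close> pairs is the finite type \<open>'n\<close>, so \<open>N\<close> is \<open>CARD('n)\<close>. All \<open>X\<^sub>i\<close> share the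
  finite type \<open>'x\<close> and all \<open>Y\<^sub>i\<close> the finite type \<open>'y\<close>; symbols may have probability zero, so this
  covers alphabets that vary with \<open>i\<close>. The law of \<open>(X, Y)\<close> is a pmf on pairs of vectors, on which
  \<open>X\<close> and \<open>Y\<close> are the projections \<open>fst\<close> and \<open>snd\<close>.
\<close>

definition independent_pairs :: "(('n::finite \<Rightarrow> 'x) \<times> ('n \<Rightarrow> 'y)) pmf \<Rightarrow> bool" where
  "independent_pairs P \<longleftrightarrow>
     (\<forall>x y. pmf P (x, y) = (\<Prod>i\<in>UNIV. pmf (map_pmf (\<lambda>(x, y). (x i, y i)) P) (x i, y i)))"

text \<open>
  Joint law of \<open>((X, Y), U)\<close> when \<open>Q (x, y)\<close> is the conditional law of \<open>U\<close> given \<open>X = x, Y = y\<close>.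
\<close>

definition joint_law :: "'a pmf \<Rightarrow> ('a \<Rightarrow> 'u pmf) \<Rightarrow> ('a \<times> 'u) pmf" where
  "joint_law P Q = bind_pmf P (\<lambda>xy. map_pmf (Pair xy) (Q xy))"

definition cond_factorizes ::
    "((('n::finite \<Rightarrow> 'x) \<times> ('n \<Rightarrow> 'y)) \<times> ('n \<Rightarrow> 'v)) pmf \<Rightarrow> bool" where
  "cond_factorizes R \<longleftrightarrow>
     (\<forall>y u. \<P>(((x', y'), u') in measure_pmf R. y' = y) > 0 \<longrightarrow>
        \<P>(((x', y'), u') in measure_pmf R. u' = u \<bar> y' = y) =
        (\<Prod>i\<in>UNIV. \<P>(((x', y'), u') in measure_pmf R. u' i = u i \<bar> y' i = y i)))"

text \<open>
  The sub-vector of \<open>Y\<close> indexed by \<open>S\<close> is \<open>restrict Y S\<close>, which is constant outside \<open>S\<close>.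
\<close>

definition Delta1 :: "(('n::finite \<Rightarrow> 'x) \<times> ('n \<Rightarrow> 'y)) pmf \<Rightarrow> 'n set \<Rightarrow> real" where
  "Delta1 P S = mutual_info P fst (\<lambda>(x, y). restrict y S) +
     (\<Sum>j\<in>S. cond_ent P (\<lambda>(x, y). x j) (\<lambda>(x, y). y j))"

definition Delta2 :: "(('n::finite \<Rightarrow> 'x) \<times> ('n \<Rightarrow> 'y)) pmf \<Rightarrow> 'n set \<Rightarrow> real" where
  "Delta2 P S = mutual_info P fst (\<lambda>(x, y). restrict y S) +
     (\<Sum>j\<in>S. ln (mutual_info P (\<lambda>(x, y). x j) (\<lambda>(x, y). y j) + 1) + 4)"

end

theory Submission
  imports Defs
begin

text \<open>
  Since \<open>I(C; U) \<le> H(C)\<close>, it is enough to find for every single pair \<open>(X\<^sub>j, Y\<^sub>j)\<close> a variable \<open>V\<^sub>j\<close>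
  independent of \<open>X\<^sub>j\<close> such that \<open>H(Y\<^sub>j | V\<^sub>j)\<close> is at most both \<open>H(X\<^sub>j)\<close> and \<open>I\<^sub>j + ln (I\<^sub>j + 1) + 4\<close>, where
  \<open>I\<^sub>j = I(X\<^sub>j; Y\<^sub>j)\<close>. The leakage is then set to the prescribed value without losing utility by
  revealing every \<open>X\<^sub>j\<close>, in addition to \<open>V\<^sub>j\<close>, with probability \<open>I(X; U) / H(X)\<close>.

  The variable \<open>V\<^sub>j\<close> is a random function \<open>F\<close> with \<open>Y\<^sub>j = F(X\<^sub>j)\<close>, that is, a coupling of the
  conditional laws of \<open>Y\<^sub>j\<close> given \<open>X\<^sub>j = x\<close>. The first bound holds because \<open>Y\<^sub>j\<close> is a function of \<open>X\<^sub>j\<close>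
  once \<open>F\<close> is given. The second is a strong functional representation lemma. The coupling is
  rejection sampling with common random draws; with it comes a sub-probability weight on the values
  of \<open>Y\<^sub>j\<close> that depends only on the draws, and the mean negative logarithm of the weight
  of \<open>Y\<^sub>j\<close> bounds \<open>H(Y\<^sub>j | V\<^sub>j)\<close> by Gibbs' inequality.
\<close>

subsection \<open>Mutual information of discrete variables\<close>

text \<open>The mean information density of a joint law. It sees two variables through their joint
  law only, so passing to another sample space leaves it unchanged.\<close>

definition info :: "('a \<times> 'b) pmf \<Rightarrow> real" where
  "info J = measure_pmf.expectation J
     (\<lambda>z. ln (pmf J z / (pmf (map_pmf fst J) (fst z) * pmf (map_pmf snd J) (snd z))))"

lemma information_space_measure_pmf: "information_space (measure_pmf p) (exp 1)"
  unfolding information_space_def information_space_axioms_def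
  by (simp add: prob_space_measure_pmf)

lemma distributed_measure_pmf:
  "distributed (measure_pmf p) (count_space UNIV) A (\<lambda>a. ennreal (pmf (map_pmf A p) a))"
  unfolding distributed_def
  by (simp add: map_pmf_rep_eq[symmetric] measure_pmf_eq_density[symmetric])

lemma count_space_pair_countable:
  "count_space (UNIV :: 'a::countable set) \<Otimes>\<^sub>M count_space (UNIV :: 'b::countable set) =
   count_space UNIV"
  by (subst pair_measure_countable) auto

lemma distributed_measure_pmf_pair:
  fixes A :: "'w \<Rightarrow> 'a::countable" and B :: "'w \<Rightarrow> 'b::countable"
  shows "distributed (measure_pmf p) (count_space UNIV \<Otimes>\<^sub>M count_space UNIV) (\<lambda>\<omega>. (A \<omega>, B \<omega>))
           (\<lambda>z. ennreal (pmf (map_pmf (\<lambda>\<omega>. (A \<omega>, B \<omega>)) p) z))"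
  unfolding count_space_pair_countable by (rule distributed_measure_pmf)

lemma integral_count_space_pmf:
  fixes f :: "'a \<Rightarrow> real"
  shows "(\<integral>z. pmf J z * f z \<partial>count_space UNIV) = measure_pmf.expectation J f"
  unfolding measure_pmf_eq_density by (subst integral_density) auto

text \<open>On countable types the product of two counting measures is again a counting measure, so
  all densities involved are pmfs.\<close>

lemma
  fixes A :: "'w \<Rightarrow> 'a::countable" and B :: "'w \<Rightarrow> 'b::countable"
  shows mutual_info_eq_info: "mutual_info p A B = info (map_pmf (\<lambda>\<omega>. (A \<omega>, B \<omega>)) p)"
    and mutual_info_nonneg: "0 \<le> mutual_info p A B"
proof -
  interpret information_space "measure_pmf p" "exp 1" by (rule information_space_measure_pmf)
  let ?J = "map_pmf (\<lambda>\<omega>. (A \<omega>, B \<omega>)) p"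
  let ?f = "\<lambda>z. pmf ?J z * ln (pmf ?J z / (pmf (map_pmf A p) (fst z) * pmf (map_pmf B p) (snd z)))"
  have sf: "sigma_finite_measure (count_space (UNIV :: 'a set))"
    "sigma_finite_measure (count_space (UNIV :: 'b set))"
    by (auto intro!: sigma_finite_measure_count_space_countable)
  have fs: "map_pmf fst ?J = map_pmf A p" "map_pmf snd ?J = map_pmf B p"
    by (simp_all add: map_pmf_comp)
  have *: "mutual_info p A B = integral\<^sup>L (count_space UNIV \<Otimes>\<^sub>M count_space UNIV) ?f"
    unfolding mutual_info_def
    using mutual_information_distr[OF sf distributed_measure_pmf _ distributed_measure_pmf _
      distributed_measure_pmf_pair, where X = A and Y = B]
    by (simp add: log_def case_prod_unfold)
  then show "mutual_info p A B = info ?J"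
    unfolding count_space_pair_countable integral_count_space_pmf info_def fs .
  show "0 \<le> mutual_info p A B"
  proof (cases "integrable (count_space UNIV \<Otimes>\<^sub>M count_space UNIV) ?f")
    case True
    then show ?thesis
      unfolding mutual_info_def
      using mutual_information_nonneg[OF sf distributed_measure_pmf _ distributed_measure_pmf _
        distributed_measure_pmf_pair, where X = A and Y = B]
      by (simp add: log_def case_prod_unfold)
  next
    \<comment> \<open>A non-integrable density has Bochner integral 0, which is still
      nonnegative.\<close>
    case False
    then show ?thesis by (simp add: * not_integrable_integral_eq)
  qed
qed

lemma cond_ent_eq:
  fixes A :: "'w \<Rightarrow> 'a::countable" and B :: "'w \<Rightarrow> 'b::countable"
  shows "cond_ent p A B = - measure_pmf.expectation (map_pmf (\<lambda>\<omega>. (A \<omega>, B \<omega>)) p)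
    (\<lambda>z. ln (pmf (map_pmf (\<lambda>\<omega>. (A \<omega>, B \<omega>)) p) z / pmf (map_pmf B p) (snd z)))"
proof -
  interpret information_space "measure_pmf p" "exp 1" by (rule information_space_measure_pmf)
  have sf: "sigma_finite_measure (count_space (UNIV :: 'a set))"
    "sigma_finite_measure (count_space (UNIV :: 'b set))"
    by (auto intro!: sigma_finite_measure_count_space_countable)
  show ?thesis
    unfolding cond_ent_def
    using conditional_entropy_generic_eq[OF sf distributed_measure_pmf _
        distributed_measure_pmf_pair, where X = A and Y = B]
    by (simp add: log_def case_prod_unfold count_space_pair_countable integral_count_space_pmf)
qed

lemma pmf_le_pmf_map: "pmf p z \<le> pmf (map_pmf h p) (h z)"
proof -
  have "measure_pmf.prob p {z} \<le> measure_pmf.prob p (h -` {h z})"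
    by (intro measure_pmf.finite_measure_mono) auto
  then show ?thesis by (simp add: pmf_map measure_pmf_single)
qed

lemma mutual_info_map:
  fixes A :: "'w \<Rightarrow> 'a::countable" and B :: "'w \<Rightarrow> 'b::countable"
  shows "mutual_info (map_pmf h p) A B = mutual_info p (\<lambda>\<omega>. A (h \<omega>)) (\<lambda>\<omega>. B (h \<omega>))"
  by (simp add: mutual_info_eq_info map_pmf_comp)

text \<open>The left-hand side serves as the Shannon entropy of \<open>A\<close> throughout. The
  joint law sits on the diagonal with the masses of \<open>A\<close>, so one of the two marginal
  factors cancels.\<close>

lemma mutual_info_self_eq:
  fixes A :: "'w \<Rightarrow> 'a::countable"
  shows "mutual_info p A A = measure_pmf.expectation p (\<lambda>\<omega>. - ln (pmf (map_pmf A p) (A \<omega>)))"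
proof -
  have inj: "pmf (map_pmf (\<lambda>\<omega>. (A \<omega>, A \<omega>)) p) (a, a) = pmf (map_pmf A p) a" for a
    using pmf_map_inj'[of "\<lambda>a. (a, a)" "map_pmf A p" a] by (simp add: inj_def map_pmf_comp)
  have "mutual_info p A A = measure_pmf.expectation p (\<lambda>\<omega>. ln (pmf (map_pmf A p) (A \<omega>) /
      (pmf (map_pmf A p) (A \<omega>) * pmf (map_pmf A p) (A \<omega>))))"
    unfolding mutual_info_eq_info info_def by (simp add: inj map_pmf_comp)
  also have "\<dots> = measure_pmf.expectation p (\<lambda>\<omega>. - ln (pmf (map_pmf A p) (A \<omega>)))"
  proof (intro integral_cong_AE, simp, simp, unfold AE_measure_pmf_iff, intro ballI)
    fix \<omega> assume "\<omega> \<in> set_pmf p"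
    then have "pmf (map_pmf A p) (A \<omega>) > 0" by (auto simp: pmf_positive_iff)
    then show "ln (pmf (map_pmf A p) (A \<omega>) / (pmf (map_pmf A p) (A \<omega>) * pmf (map_pmf A p) (A \<omega>))) =
        - ln (pmf (map_pmf A p) (A \<omega>))"
      by (simp add: ln_div ln_mult)
  qed
  finally show ?thesis .
qed

text \<open>Holds pointwise for the densities, because a pair is at most as probable as its second
  entry. Finiteness of \<open>'a\<close> makes the entropy integrable, while \<open>B\<close> may
  take countably many values, as \<open>U\<close> does.\<close>

lemma mutual_info_le_self:
  fixes A :: "'w \<Rightarrow> 'a::{countable,finite}" and B :: "'w \<Rightarrow> 'b::countable"
  shows "mutual_info p A B \<le> mutual_info p A A"
proof -
  let ?J = "map_pmf (\<lambda>\<omega>. (A \<omega>, B \<omega>)) p"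
  let ?f = "\<lambda>\<omega>. ln (pmf ?J (A \<omega>, B \<omega>) / (pmf (map_pmf A p) (A \<omega>) * pmf (map_pmf B p) (B \<omega>)))"
  have eq: "mutual_info p A B = measure_pmf.expectation p ?f"
    unfolding mutual_info_eq_info info_def by (simp add: map_pmf_comp)
  show ?thesis
  proof (cases "integrable p ?f")
    case True
    have int: "integrable p (\<lambda>\<omega>. - ln (pmf (map_pmf A p) (A \<omega>)))"
      using integrable_measure_pmf_finite[of "map_pmf A p" "\<lambda>a. - ln (pmf (map_pmf A p) a)"]
      by simp
    have le: "?f \<omega> \<le> - ln (pmf (map_pmf A p) (A \<omega>))" if w: "\<omega> \<in> set_pmf p" for \<omega>
    proof -
      have pos: "pmf ?J (A \<omega>, B \<omega>) > 0" "pmf (map_pmf A p) (A \<omega>) > 0" "pmf (map_pmf B p) (B \<omega>) > 0"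
        using w by (auto simp: pmf_positive_iff)
      have "pmf ?J (A \<omega>, B \<omega>) \<le> pmf (map_pmf snd ?J) (snd (A \<omega>, B \<omega>))"
        by (rule pmf_le_pmf_map)
      also have "\<dots> = pmf (map_pmf B p) (B \<omega>)" by (simp add: map_pmf_comp)
      finally have "ln (pmf ?J (A \<omega>, B \<omega>)) \<le> ln (pmf (map_pmf B p) (B \<omega>))"
        using pos by simp
      then show ?thesis using pos by (simp add: ln_div ln_mult)
    qed
    show ?thesis unfolding eq mutual_info_self_eq
      by (intro integral_mono_AE True int) (auto simp: AE_measure_pmf_iff le)
  next
    case False
    then have "mutual_info p A B = 0" unfolding eq by (rule not_integrable_integral_eq)
    then show ?thesis using mutual_info_nonneg[of p A A] by simp
  qed
qed

lemma cond_ent_eq_diff: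
  fixes A :: "'w \<Rightarrow> 'a::finite" and B :: "'w \<Rightarrow> 'b::finite"
  shows "cond_ent p A B = mutual_info p A A - mutual_info p A B"
proof -
  let ?J = "map_pmf (\<lambda>\<omega>. (A \<omega>, B \<omega>)) p"
  have int: "integrable p (\<lambda>\<omega>. f (A \<omega>, B \<omega>))" for f :: "_ \<Rightarrow> real"
    using integrable_measure_pmf_finite[of ?J f] by simp
  have "mutual_info p A A - mutual_info p A B = measure_pmf.expectation p (\<lambda>\<omega>. - ln (pmf (map_pmf A p) (A \<omega>)) -
     ln (pmf ?J (A \<omega>, B \<omega>) / (pmf (map_pmf A p) (A \<omega>) * pmf (map_pmf B p) (B \<omega>))))"
    unfolding mutual_info_self_eq
    unfolding mutual_info_eq_info info_def
    using int[of "\<lambda>z. - ln (pmf (map_pmf A p) (fst z))"]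
      int[of "\<lambda>z. ln (pmf ?J z / (pmf (map_pmf A p) (fst z) * pmf (map_pmf B p) (snd z)))"]
    by (simp add: map_pmf_comp)
  also have "\<dots> = measure_pmf.expectation p (\<lambda>\<omega>. - ln (pmf ?J (A \<omega>, B \<omega>) / pmf (map_pmf B p) (B \<omega>)))"
  proof (intro integral_cong_AE, simp, simp, unfold AE_measure_pmf_iff, intro ballI)
    fix \<omega> assume w: "\<omega> \<in> set_pmf p"
    have pos: "pmf ?J (A \<omega>, B \<omega>) > 0" "pmf (map_pmf A p) (A \<omega>) > 0" "pmf (map_pmf B p) (B \<omega>) > 0"
        using w by (auto simp: pmf_positive_iff)
    then show "- ln (pmf (map_pmf A p) (A \<omega>)) -
     ln (pmf ?J (A \<omega>, B \<omega>) / (pmf (map_pmf A p) (A \<omega>) * pmf (map_pmf B p) (B \<omega>))) = - ln (pmf ?J (A \<omega>, B \<omega>) / pmf (map_pmf B p) (B \<omega>))"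
      by (simp add: ln_div ln_mult)
  qed
  finally show ?thesis unfolding cond_ent_eq by simp
qed

lemma mutual_info_commute:
  fixes A :: "'w \<Rightarrow> 'a::countable" and B :: "'w \<Rightarrow> 'b::countable"
  shows "mutual_info p A B = mutual_info p B A"
proof -
  have "pmf (map_pmf (\<lambda>\<omega>. (A \<omega>, B \<omega>)) p) (a, b) = pmf (map_pmf (\<lambda>\<omega>. (B \<omega>, A \<omega>)) p) (b, a)" for a b
    unfolding pmf_map by (rule arg_cong[of _ _ "measure_pmf.prob p"]) auto
  then show ?thesis
    unfolding mutual_info_eq_info info_def by (simp add: map_pmf_comp mult.commute)
qed

text \<open>Gibbs' inequality, in the form H(A|B) <= E[- ln w], where \<open>w b\<close> is any
  sub-probability guess of the law of \<open>A\<close> given \<open>b\<close>. It comes from ln s <=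
  s - 1, with s the ratio of the guess to the true posterior.\<close>

lemma mutual_info_ge_cross_entropy:
  fixes A :: "'w \<Rightarrow> 'a::finite" and B :: "'w \<Rightarrow> 'b::countable" and w :: "'b \<Rightarrow> 'a \<Rightarrow> real"
  assumes fin: "finite (set_pmf p)"
    and nonneg: "\<And>b a. b \<in> B ` set_pmf p \<Longrightarrow> w b a \<ge> 0"
    and le1: "\<And>b. b \<in> B ` set_pmf p \<Longrightarrow> (\<Sum>a\<in>UNIV. w b a) \<le> 1"
    and pos: "\<And>\<omega>. \<omega> \<in> set_pmf p \<Longrightarrow> w (B \<omega>) (A \<omega>) > 0"
  shows "mutual_info p A A - measure_pmf.expectation p (\<lambda>\<omega>. - ln (w (B \<omega>) (A \<omega>))) \<le> mutual_info p A B"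
proof -
  let ?J = "map_pmf (\<lambda>\<omega>. (A \<omega>, B \<omega>)) p"
  let ?p = "\<lambda>\<omega>. pmf ?J (A \<omega>, B \<omega>)" and ?q = "\<lambda>\<omega>. pmf (map_pmf A p) (A \<omega>)"
    and ?r = "\<lambda>\<omega>. pmf (map_pmf B p) (B \<omega>)"
  have int: "integrable p f" for f :: "_ \<Rightarrow> real"
    using fin by (rule integrable_measure_pmf_finite)
  have "1 - measure_pmf.expectation p (\<lambda>\<omega>. w (B \<omega>) (A \<omega>) * ?r \<omega> / ?p \<omega>) =
      measure_pmf.expectation p (\<lambda>\<omega>. 1 - w (B \<omega>) (A \<omega>) * ?r \<omega> / ?p \<omega>)"
    by (subst Bochner_Integration.integral_diff) (auto intro: int)
  also have "\<dots> \<le> measure_pmf.expectation p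
    (\<lambda>\<omega>. ln (?p \<omega> / (?q \<omega> * ?r \<omega>)) - (- ln (?q \<omega>)) + (- ln (w (B \<omega>) (A \<omega>))))"
  proof (intro integral_mono_AE int, unfold AE_measure_pmf_iff, intro ballI)
    fix \<omega> assume \<omega>: "\<omega> \<in> set_pmf p"
    then have *: "?p \<omega> > 0" "?q \<omega> > 0" "?r \<omega> > 0" "w (B \<omega>) (A \<omega>) > 0"
      by (auto simp: pmf_positive_iff pos)
    then have "ln (w (B \<omega>) (A \<omega>) * ?r \<omega> / ?p \<omega>) \<le> w (B \<omega>) (A \<omega>) * ?r \<omega> / ?p \<omega> - 1"
      by (intro ln_le_minus_one) simp
    with * show "1 - w (B \<omega>) (A \<omega>) * ?r \<omega> / ?p \<omega> \<le>
        ln (?p \<omega> / (?q \<omega> * ?r \<omega>)) - (- ln (?q \<omega>)) + (- ln (w (B \<omega>) (A \<omega>)))"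
      by (simp add: ln_div ln_mult)
  qed
  also have "\<dots> = mutual_info p A B - mutual_info p A A +
      measure_pmf.expectation p (\<lambda>\<omega>. - ln (w (B \<omega>) (A \<omega>)))"
  proof -
    have "mutual_info p A B = measure_pmf.expectation p (\<lambda>\<omega>. ln (?p \<omega> / (?q \<omega> * ?r \<omega>)))"
      unfolding mutual_info_eq_info info_def by (simp add: map_pmf_comp)
    then show ?thesis
      unfolding mutual_info_self_eq
      by (subst Bochner_Integration.integral_add[OF int int],
          subst Bochner_Integration.integral_diff[OF int int]) simp
  qed
  finally have main: "1 - measure_pmf.expectation p (\<lambda>\<omega>. w (B \<omega>) (A \<omega>) * ?r \<omega> / ?p \<omega>) \<le>
      mutual_info p A B - mutual_info p A A +
      measure_pmf.expectation p (\<lambda>\<omega>. - ln (w (B \<omega>) (A \<omega>)))" .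
  have finB: "finite (B ` set_pmf p)" using fin by simp
  \<comment> \<open>The ratio has mean at most 1: the joint mass cancels on its support, the sum
    then extends to all letters, and every \<open>w b\<close> has mass at most 1.\<close>
  have "measure_pmf.expectation p (\<lambda>\<omega>. w (B \<omega>) (A \<omega>) * ?r \<omega> / ?p \<omega>) =
      measure_pmf.expectation ?J (\<lambda>z. w (snd z) (fst z) * pmf (map_pmf B p) (snd z) / pmf ?J z)"
    by simp
  also have "\<dots> = (\<Sum>z\<in>set_pmf ?J. pmf ?J z *\<^sub>R (w (snd z) (fst z) * pmf (map_pmf B p) (snd z) / pmf ?J z))"
    using fin by (intro integral_measure_pmf) simp_all
  also have "\<dots> = (\<Sum>z\<in>set_pmf ?J. w (snd z) (fst z) * pmf (map_pmf B p) (snd z))"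
    by (intro sum.cong refl) (use set_pmf_iff in fastforce)
  also have "\<dots> \<le> (\<Sum>z\<in>UNIV \<times> B ` set_pmf p. w (snd z) (fst z) * pmf (map_pmf B p) (snd z))"
    using finB by (intro sum_mono2) (auto intro!: mult_nonneg_nonneg nonneg)
  also have "\<dots> = (\<Sum>b\<in>B ` set_pmf p. (\<Sum>a\<in>UNIV. w b a) * pmf (map_pmf B p) b)"
    unfolding sum_distrib_right by (subst sum.swap) (simp add: sum.cartesian_product case_prod_unfold)
  also have "\<dots> \<le> (\<Sum>b\<in>B ` set_pmf p. 1 * pmf (map_pmf B p) b)"
    by (intro sum_mono mult_right_mono le1) auto
  also have "\<dots> = 1"
    using finB by (simp add: sum_pmf_eq_1)
  finally show ?thesis using main by simp
qed

section \<open>Product laws and additivity of information\<close>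

lemma prob_Pi_pmf_UNIV:
  fixes R :: "'n::finite \<Rightarrow> 'c pmf"
  shows "measure_pmf.prob (Pi_pmf UNIV d R) {\<omega>. \<forall>j. \<omega> j \<in> B j} = (\<Prod>j\<in>UNIV. measure_pmf.prob (R j) (B j))"
proof -
  have "{\<omega>. \<forall>j. \<omega> j \<in> B j} = PiE_dflt UNIV d B"
    by (auto simp: PiE_dflt_def)
  then show ?thesis by (simp add: measure_Pi_pmf_PiE_dflt)
qed

lemma pmf_map_Pi_pmf_UNIV:
  fixes R :: "'n::finite \<Rightarrow> 'c pmf"
  shows "pmf (map_pmf (\<lambda>\<omega> j. h j (\<omega> j)) (Pi_pmf UNIV d R)) a = (\<Prod>j\<in>UNIV. pmf (map_pmf (h j) (R j)) (a j))"
proof -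
  have "(\<lambda>\<omega> j. h j (\<omega> j)) -` {a} = {\<omega>. \<forall>j. \<omega> j \<in> h j -` {a j}}"
    by (auto simp: fun_eq_iff)
  then show ?thesis unfolding pmf_map by (simp only: prob_Pi_pmf_UNIV)
qed

lemma pmf_map_Pair_Pi_pmf_UNIV:
  fixes R :: "'n::finite \<Rightarrow> 'c pmf"
  shows "pmf (map_pmf (\<lambda>\<omega>. (\<lambda>j. f j (\<omega> j), \<lambda>j. g j (\<omega> j))) (Pi_pmf UNIV d R)) (a, b) =
    (\<Prod>j\<in>UNIV. pmf (map_pmf (\<lambda>z. (f j z, g j z)) (R j)) (a j, b j))"
proof -
  have "(\<lambda>\<omega>. (\<lambda>j. f j (\<omega> j), \<lambda>j. g j (\<omega> j))) -` {(a, b)} =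
      {\<omega>. \<forall>j. \<omega> j \<in> (\<lambda>z. (f j z, g j z)) -` {(a j, b j)}}"
    by (auto simp: fun_eq_iff)
  then show ?thesis unfolding pmf_map by (simp only: prob_Pi_pmf_UNIV)
qed

lemma finite_set_Pi_pmf:
  assumes "finite A" "\<And>j. j \<in> A \<Longrightarrow> finite (set_pmf (R j))"
  shows "finite (set_pmf (Pi_pmf A d R))"
  using assms by (auto simp: set_Pi_pmf)

text \<open>Joint law and marginals factorize over the coordinates, so the log ratio of the vectors
  is a sum of terms that each depend on a single component.\<close>

lemma mutual_info_Pi_pmf:
  fixes R :: "'n::finite \<Rightarrow> 'c pmf" and f :: "'n \<Rightarrow> 'c \<Rightarrow> 'a::countable" and g :: "'n \<Rightarrow> 'c \<Rightarrow> 'b::countable"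
  assumes fin: "\<And>j. finite (set_pmf (R j))"
  shows "mutual_info (Pi_pmf UNIV d R) (\<lambda>\<omega> j. f j (\<omega> j)) (\<lambda>\<omega> j. g j (\<omega> j)) =
    (\<Sum>j\<in>UNIV. mutual_info (R j) (f j) (g j))"
proof -
  let ?M = "Pi_pmf UNIV d R"
  define r where "r j z = pmf (map_pmf (\<lambda>z. (f j z, g j z)) (R j)) (f j z, g j z) /
    (pmf (map_pmf (f j) (R j)) (f j z) * pmf (map_pmf (g j) (R j)) (g j z))" for j z
  have finM: "finite (set_pmf ?M)" using fin by (intro finite_set_Pi_pmf) auto
  have "mutual_info ?M (\<lambda>\<omega> j. f j (\<omega> j)) (\<lambda>\<omega> j. g j (\<omega> j)) =
      measure_pmf.expectation ?M (\<lambda>\<omega>. ln (\<Prod>j\<in>UNIV. r j (\<omega> j)))"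
    unfolding mutual_info_eq_info info_def
    by (simp add: map_pmf_comp pmf_map_Pi_pmf_UNIV pmf_map_Pair_Pi_pmf_UNIV r_def
        prod_dividef prod.distrib)
  also have "\<dots> = measure_pmf.expectation ?M (\<lambda>\<omega>. \<Sum>j\<in>UNIV. ln (r j (\<omega> j)))"
  proof (intro integral_cong_AE, simp, simp, unfold AE_measure_pmf_iff, intro ballI)
    fix \<omega> assume "\<omega> \<in> set_pmf ?M"
    then have "\<omega> j \<in> set_pmf (R j)" for j by (auto simp: set_Pi_pmf PiE_dflt_def)
    then have "r j (\<omega> j) > 0" for j
      unfolding r_def by (auto intro!: divide_pos_pos mult_pos_pos simp: pmf_positive_iff)
    then show "ln (\<Prod>j\<in>UNIV. r j (\<omega> j)) = (\<Sum>j\<in>UNIV. ln (r j (\<omega> j)))"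
      by (intro ln_prod) (auto simp: less_imp_neq[symmetric])
  qed
  also have "\<dots> = (\<Sum>j\<in>UNIV. measure_pmf.expectation ?M (\<lambda>\<omega>. ln (r j (\<omega> j))))"
    by (intro Bochner_Integration.integral_sum integrable_measure_pmf_finite finM)
  also have "\<dots> = (\<Sum>j\<in>UNIV. mutual_info (R j) (f j) (g j))"
  proof (intro sum.cong refl)
    fix j
    have "measure_pmf.expectation ?M (\<lambda>\<omega>. ln (r j (\<omega> j))) =
        measure_pmf.expectation (map_pmf (\<lambda>\<omega>. \<omega> j) ?M) (\<lambda>z. ln (r j z))"
      by simp
    also have "map_pmf (\<lambda>\<omega>. \<omega> j) ?M = R j" by (simp add: Pi_pmf_component)
    finally show "measure_pmf.expectation ?M (\<lambda>\<omega>. ln (r j (\<omega> j))) = mutual_info (R j) (f j) (g j)"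
      unfolding mutual_info_eq_info info_def by (simp add: map_pmf_comp r_def)
  qed
  finally show ?thesis .
qed

text \<open>Serves the coordinates outside a sub-vector, where \<open>restrict\<close> is
  constant.\<close>

lemma mutual_info_const [simp]:
  fixes B :: "'w \<Rightarrow> 'b::countable" and c :: "'a::countable"
  shows "mutual_info p (\<lambda>_. c) B = 0"
proof -
  have "pmf (map_pmf (\<lambda>\<omega>. (c, B \<omega>)) p) (c, b) = pmf (map_pmf B p) b" for b
    using pmf_map_inj'[of "Pair c" "map_pmf B p" b] by (simp add: inj_def map_pmf_comp)
  then have "mutual_info p (\<lambda>_. c) B = measure_pmf.expectation p
      (\<lambda>\<omega>. ln (pmf (map_pmf B p) (B \<omega>) / pmf (map_pmf B p) (B \<omega>)))"
    unfolding mutual_info_eq_info info_def by (simp add: map_pmf_comp map_pmf_const)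
  also have "\<dots> = measure_pmf.expectation p (\<lambda>\<omega>. 0)"
    by (intro integral_cong_AE) (auto simp: AE_measure_pmf_iff set_pmf_iff[symmetric])
  finally show ?thesis by simp
qed

subsection \<open>Coupling by rejection sampling\<close>

lemma exists_normalized_pmf:
  fixes \<mu> :: "'c \<Rightarrow> real"
  assumes "finite R" "\<And>c. c \<in> R \<Longrightarrow> \<mu> c \<ge> 0" "sum \<mu> R > 0"
  obtains D where "\<And>c. pmf D c = (if c \<in> R then \<mu> c / sum \<mu> R else 0)" "set_pmf D \<subseteq> R"
proof -
  let ?f = "\<lambda>c. if c \<in> R then \<mu> c / sum \<mu> R else 0"
  have "(\<integral>\<^sup>+c. ennreal (?f c) \<partial>count_space UNIV) = (\<Sum>c\<in>R. ennreal (?f c))"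
    using assms(1) by (intro nn_integral_count_space') auto
  also have "\<dots> = ennreal (\<Sum>c\<in>R. ?f c)"
    using assms by (intro sum_ennreal) auto
  also have "(\<Sum>c\<in>R. ?f c) = 1"
    using assms by (simp add: sum_divide_distrib[symmetric])
  finally have "pmf (embed_pmf ?f) c = ?f c" for c
    using assms by (intro pmf_embed_pmf) auto
  then show ?thesis
    by (intro that[of "embed_pmf ?f"]) (auto simp: set_pmf_eq)
qed

text \<open>The first sum pays for stopping at the accepted cell, the second for passing the
  rejected cells before it.\<close>

definition cell_cost :: "('c \<Rightarrow> real) \<Rightarrow> ('c \<Rightarrow> real) \<Rightarrow> 'c set \<Rightarrow> 'c set \<Rightarrow> real" where
  "cell_cost \<mu> \<phi> C B = (\<Sum>c\<in>B. \<mu> c * - ln (\<phi> c)) + (\<Sum>c\<in>C - B. \<mu> c * - ln (1 - \<phi> c))"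

text \<open>
  Cells are drawn independently with law proportional to \<open>\<mu>\<close>, and every \<open>x\<close> is sent to the label of
  the first drawn cell in \<open>B x\<close>. The weight is the law of the label at which a decoder that only sees
  the draws stops, if it stops at each drawn cell \<open>c\<close> with probability \<open>\<phi> c\<close>. Before \<open>B x\<close> is hit, a
  cell \<open>c\<close> outside \<open>B x\<close> is drawn \<open>\<mu> c\<close> times on average, which gives the cost. The construction is
  recursive in the set \<open>A\<close> of those \<open>x\<close> that are not yet served, and it skips the draws that serve
  nobody, so that all laws have finite support.
\<close>

lemma greedy_coupling:
  fixes \<mu> \<phi> :: "'c \<Rightarrow> real" and B :: "'x \<Rightarrow> 'c set" and lab :: "'c \<Rightarrow> 'y::finite"
  assumes finC: "finite C" and \<mu>: "\<And>c. c \<in> C \<Longrightarrow> \<mu> c \<ge> 0"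
    and \<phi>: "\<And>c. c \<in> C \<Longrightarrow> 0 < \<phi> c" "\<And>c. c \<in> C \<Longrightarrow> \<phi> c < 1"
    and "finite A" and "\<And>x. x \<in> A \<Longrightarrow> B x \<subseteq> C" "\<And>x. x \<in> A \<Longrightarrow> sum \<mu> (B x) = 1"
  shows "\<exists>G :: (('x \<Rightarrow> 'y) \<times> ('y \<Rightarrow> real)) pmf. finite (set_pmf G) \<and>
    (\<forall>z\<in>set_pmf G. (\<forall>y. 0 \<le> snd z y) \<and> (\<Sum>y\<in>UNIV. snd z y) \<le> 1 \<and> (\<forall>x\<in>A. 0 < snd z (fst z x))) \<and>
    (\<forall>x\<in>A. \<forall>y. pmf (map_pmf (\<lambda>z. fst z x) G) y = sum \<mu> {c \<in> B x. lab c = y}) \<and>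
    (\<forall>x\<in>A. measure_pmf.expectation G (\<lambda>z. - ln (snd z (fst z x))) \<le> cell_cost \<mu> \<phi> C (B x))"
    (is "\<exists>G. ?P A G")
  using assms(5-7)
proof (induction A rule: finite_psubset_induct)
  case (psubset A)
  show ?case
  proof (cases "A = {}")
    case True
    \<comment> \<open>With nobody left to serve, positivity is demanded nowhere, so the zero weight
      is admissible.\<close>
    then show ?thesis by (intro exI[of _ "return_pmf (\<lambda>_. undefined, \<lambda>_. 0)"]) auto
  next
    case False
    then obtain x0 where x0: "x0 \<in> A" by auto
    \<comment> \<open>Only cells accepted by some unserved \<open>x\<close> are drawn. Their mass
      \<open>W\<close> is at least 1, since a single acceptance set already has mass 1.\<close>
    define R where "R = (\<Union>x\<in>A. B x)"
    define W where "W = sum \<mu> R"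
    have RC: "R \<subseteq> C" using psubset.prems by (auto simp: R_def)
    then have finR: "finite R" using finC finite_subset by blast
    have BR: "B x \<subseteq> R" if "x \<in> A" for x using that by (auto simp: R_def)
    have "sum \<mu> (B x0) \<le> W" unfolding W_def
      using RC finR x0 by (intro sum_mono2) (auto simp: R_def intro: \<mu>)
    then have W: "W \<ge> 1" using psubset.prems x0 by simp
    obtain D where D: "\<And>c. pmf D c = (if c \<in> R then \<mu> c / W else 0)" "set_pmf D \<subseteq> R"
      using exists_normalized_pmf[OF finR, of \<mu>] \<mu> RC W unfolding W_def by (metis less_le_trans subsetD zero_less_one)
    \<comment> \<open>Every \<open>c\<close> in \<open>R\<close> serves at least one
      \<open>x\<close>, so the set of those still waiting shrinks strictly and the induction
      hypothesis applies.\<close>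
    define A' where "A' c = {x \<in> A. c \<notin> B x}" for c
    have ex: "\<exists>G. ?P (A' c) G" if "c \<in> R" for c
      using that psubset.prems by (intro psubset.IH) (auto simp: A'_def R_def)
    define G where "G c = (SOME G. ?P (A' c) G)" for c
    have G: "?P (A' c) (G c)" if "c \<in> R" for c
      unfolding G_def by (rule someI_ex) (rule ex[OF that])
    have finG: "finite (set_pmf (G c))" if "c \<in> R" for c
      by (rule conjunct1[OF G[OF that]])
    have G_weight: "0 \<le> snd z y" "(\<Sum>y\<in>UNIV. snd z y) \<le> 1" "x \<in> A' c \<Longrightarrow> 0 < snd z (fst z x)"
      if "c \<in> R" "z \<in> set_pmf (G c)" for c z x y
      using conjunct1[OF conjunct2[OF G[OF that(1)]]] that(2) by blast+
    have G_marginal: "pmf (map_pmf (\<lambda>z. fst z x) (G c)) y = sum \<mu> {c \<in> B x. lab c = y}"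
      if "c \<in> R" "x \<in> A' c" for c x y
      using conjunct1[OF conjunct2[OF conjunct2[OF G[OF that(1)]]]] that(2) by blast
    have G_cost: "measure_pmf.expectation (G c) (\<lambda>z. - ln (snd z (fst z x))) \<le> cell_cost \<mu> \<phi> C (B x)"
      if "c \<in> R" "x \<in> A' c" for c x
      using conjunct2[OF conjunct2[OF conjunct2[OF G[OF that(1)]]]] that(2) by blast
    \<comment> \<open>The drawn cell fixes the value at every \<open>x\<close> that accepts it and
      leaves the others to the recursive coupling. The weight mixes a stop at \<open>c\<close> with
      the recursive weight.\<close>
    define step where "step c z = ((\<lambda>x. if c \<in> B x then lab c else fst z x),
      (\<lambda>y. \<phi> c * of_bool (y = lab c) + (1 - \<phi> c) * snd z y))" for c and z :: "('x \<Rightarrow> 'y) \<times> ('y \<Rightarrow> real)"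
    define H where "H = bind_pmf D (\<lambda>c. map_pmf (step c) (G c))"
    have setH: "\<exists>c\<in>R. \<exists>z\<in>set_pmf (G c). z' = step c z" if "z' \<in> set_pmf H" for z'
      using that D(2) by (auto simp: H_def)
    have "finite (set_pmf H)"
    proof -
      have "finite (set_pmf D)" using D(2) finR by (rule finite_subset)
      then show ?thesis unfolding H_def set_bind_pmf using D(2) finG by (intro finite_UN_I) auto
    qed
    moreover have "(\<forall>y. 0 \<le> snd z' y) \<and> (\<Sum>y\<in>UNIV. snd z' y) \<le> 1 \<and> (\<forall>x\<in>A. 0 < snd z' (fst z' x))"
      if z': "z' \<in> set_pmf H" for z'
    proof -
      obtain c z where c: "c \<in> R" "z \<in> set_pmf (G c)" "z' = step c z" using setH[OF z'] by auto
      have z: "\<And>y. 0 \<le> snd z y" "(\<Sum>y\<in>UNIV. snd z y) \<le> 1" "\<And>x. x \<in> A' c \<Longrightarrow> 0 < snd z (fst z x)"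
        by (fact G_weight[OF c(1,2)])+
      have \<phi>c: "0 < \<phi> c" "\<phi> c < 1" using c RC \<phi> by auto
      have "(\<Sum>y\<in>UNIV. snd z' y) = \<phi> c * (\<Sum>y\<in>UNIV. of_bool (y = lab c)) + (1 - \<phi> c) * (\<Sum>y\<in>UNIV. snd z y)"
        unfolding c(3) step_def by (simp add: sum.distrib sum_distrib_left)
      also have "(\<Sum>y\<in>UNIV. of_bool (y = lab c)) = (1::real)"
        by (simp add: of_bool_def)
      also have "\<phi> c * 1 + (1 - \<phi> c) * (\<Sum>y\<in>UNIV. snd z y) \<le> \<phi> c * 1 + (1 - \<phi> c) * 1"
        using z \<phi>c by (intro add_left_mono mult_left_mono) auto
      finally have "(\<Sum>y\<in>UNIV. snd z' y) \<le> 1" by simp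
      moreover have "0 \<le> snd z' y" for y
        using z(1)[of y] \<phi>c by (simp add: c(3) step_def)
      moreover have "0 < snd z' (fst z' x)" if "x \<in> A" for x
      proof (cases "c \<in> B x")
        case True
        then show ?thesis
          using z(1)[of "lab c"] \<phi>c by (auto simp: c(3) step_def intro!: add_pos_nonneg)
      next
        case False
        then have "0 < (1 - \<phi> c) * snd z (fst z x)" using z(3)[of x] that \<phi>c by (simp add: A'_def)
        then show ?thesis
          using False \<phi>c by (auto simp: c(3) step_def intro!: add_nonneg_pos)
      qed
      ultimately show ?thesis by blast
    qed
    moreover have "pmf (map_pmf (\<lambda>z. fst z x) H) y = sum \<mu> {c \<in> B x. lab c = y}" if x: "x \<in> A" for x y
    proof -
      let ?m = "sum \<mu> {c \<in> B x. lab c = y}"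
      have *: "pmf (map_pmf (\<lambda>z. fst z x) (map_pmf (step c) (G c))) y = (if c \<in> B x then of_bool (lab c = y) else ?m)"
        if "c \<in> R" for c
        using G_marginal[OF that, of x y] x by (auto simp: map_pmf_comp step_def map_pmf_const A'_def)
      \<comment> \<open>A fixed point: the draw is accepted with label \<open>y\<close> with
        probability \<open>?m / W\<close>, and is rejected with probability
        \<open>(W - 1) / W\<close>, after which the recursion yields \<open>?m\<close>.\<close>
      have "pmf (map_pmf (\<lambda>z. fst z x) H) y =
          (\<Sum>c\<in>R. pmf (map_pmf (\<lambda>z. fst z x) (map_pmf (step c) (G c))) y * pmf D c)"
        unfolding H_def map_bind_pmf pmf_bind
        using finR D(2) by (intro integral_measure_pmf_real) auto
      also have "\<dots> = (\<Sum>c\<in>R. (if c \<in> B x then of_bool (lab c = y) * \<mu> c else ?m * \<mu> c) / W)"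
        by (intro sum.cong refl) (simp add: * D(1))
      also have "\<dots> = ((\<Sum>c\<in>B x. of_bool (lab c = y) * \<mu> c) + (\<Sum>c\<in>R - B x. ?m * \<mu> c)) / W"
        using finR BR[OF x] by (simp add: sum_divide_distrib[symmetric] sum.If_cases Int_absorb1 Diff_eq)
      also have "(\<Sum>c\<in>B x. of_bool (lab c = y) * \<mu> c) = ?m"
        using finR BR[OF x] by (auto simp: of_bool_def if_distrib[of "\<lambda>t. t * _"] sum.inter_filter finite_subset cong: if_cong)
      also have "(\<Sum>c\<in>R - B x. ?m * \<mu> c) = ?m * (W - 1)"
        using finR BR[OF x] x psubset.prems by (simp add: sum_distrib_left[symmetric] sum_diff W_def finite_subset)
      also have "(?m + ?m * (W - 1)) / W = ?m" using W by (simp add: field_simps)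
      finally show ?thesis .
    qed
    moreover have "measure_pmf.expectation H (\<lambda>z. - ln (snd z (fst z x))) \<le> cell_cost \<mu> \<phi> C (B x)"
      if x: "x \<in> A" for x
    proof -
      let ?K = "cell_cost \<mu> \<phi> C (B x)"
      \<comment> \<open>The weight is bounded below by one of its two nonnegative terms: the stop at
        \<open>c\<close> if \<open>x\<close> accepts it, the recursive weight otherwise.\<close>
      have *: "measure_pmf.expectation (map_pmf (step c) (G c)) (\<lambda>z. - ln (snd z (fst z x))) \<le>
          (if c \<in> B x then - ln (\<phi> c) else - ln (1 - \<phi> c) + ?K)" (is "?E c \<le> _") if c: "c \<in> R" for c
      proof -
        have \<phi>c: "0 < \<phi> c" "\<phi> c < 1" using c RC \<phi> by auto
        note int = integrable_measure_pmf_finite[OF finG[OF c]]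
        have z: "0 \<le> snd z y" "x \<in> A' c \<Longrightarrow> 0 < snd z (fst z x)" if "z \<in> set_pmf (G c)" for z y
          by (fact G_weight[OF c that])+
        show ?thesis
        proof (cases "c \<in> B x")
          case True
          have "measure_pmf.expectation (G c) (\<lambda>z. - ln (snd (step c z) (fst (step c z) x))) \<le>
              measure_pmf.expectation (G c) (\<lambda>z. - ln (\<phi> c))"
          proof (intro integral_mono_AE int, unfold AE_measure_pmf_iff, intro ballI)
            fix z assume "z \<in> set_pmf (G c)"
            then have "\<phi> c \<le> snd (step c z) (fst (step c z) x)"
              using True \<phi>c z by (simp add: step_def)
            then show "- ln (snd (step c z) (fst (step c z) x)) \<le> - ln (\<phi> c)"
              using \<phi>c by simp
          qed
          then show ?thesis using True by simp
        next
          case False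
          then have xA': "x \<in> A' c" using x by (simp add: A'_def)
          have "measure_pmf.expectation (G c) (\<lambda>z. - ln (snd (step c z) (fst (step c z) x))) \<le>
              measure_pmf.expectation (G c) (\<lambda>z. - ln (1 - \<phi> c) + - ln (snd z (fst z x)))"
          proof (intro integral_mono_AE int, unfold AE_measure_pmf_iff, intro ballI)
            fix z assume "z \<in> set_pmf (G c)"
            then have pos: "0 < snd z (fst z x)" using xA' z by simp
            have "(1 - \<phi> c) * snd z (fst z x) \<le> snd (step c z) (fst (step c z) x)"
              using False \<phi>c by (simp add: step_def)
            moreover have "(1 - \<phi> c) * snd z (fst z x) > 0" using \<phi>c pos by simp
            ultimately have "ln ((1 - \<phi> c) * snd z (fst z x)) \<le> ln (snd (step c z) (fst (step c z) x))"
              by simp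
            then show "- ln (snd (step c z) (fst (step c z) x)) \<le> - ln (1 - \<phi> c) + - ln (snd z (fst z x))"
              using \<phi>c pos by (simp add: ln_mult)
          qed
          also have "\<dots> = - ln (1 - \<phi> c) + measure_pmf.expectation (G c) (\<lambda>z. - ln (snd z (fst z x)))"
            by (subst Bochner_Integration.integral_add[OF int int]) simp
          also have "\<dots> \<le> - ln (1 - \<phi> c) + ?K"
            using G_cost[OF c xA'] by simp
          finally show ?thesis using False by simp
        qed
      qed
      have "measure_pmf.expectation H (\<lambda>z. - ln (snd z (fst z x))) = (\<Sum>c\<in>R. pmf D c *\<^sub>R ?E c)"
        unfolding H_def using finR D(2) finG by (intro pmf_expectation_bind) auto
      also have "\<dots> \<le> (\<Sum>c\<in>R. (\<mu> c / W) * (if c \<in> B x then - ln (\<phi> c) else - ln (1 - \<phi> c) + ?K))"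
      proof (rule sum_mono)
        fix c assume c: "c \<in> R"
        then have "0 \<le> \<mu> c / W" using W RC \<mu> by (intro divide_nonneg_nonneg) auto
        then show "pmf D c *\<^sub>R ?E c \<le>
            (\<mu> c / W) * (if c \<in> B x then - ln (\<phi> c) else - ln (1 - \<phi> c) + ?K)"
          unfolding D(1) real_scaleR_def using c by (simp only: if_True) (intro mult_left_mono *)
      qed
      also have "\<dots> = (\<Sum>c\<in>R. (if c \<in> B x then \<mu> c * - ln (\<phi> c) else \<mu> c * - ln (1 - \<phi> c) + \<mu> c * ?K)) / W"
        unfolding sum_divide_distrib by (intro sum.cong refl) (simp add: field_simps)
      also have "\<dots> = ((\<Sum>c\<in>B x. \<mu> c * - ln (\<phi> c)) + (\<Sum>c\<in>R - B x. \<mu> c * - ln (1 - \<phi> c) + \<mu> c * ?K)) / W"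
        using finR BR[OF x] by (simp add: sum.If_cases Int_absorb1 Diff_eq)
      also have "\<dots> = ((\<Sum>c\<in>B x. \<mu> c * - ln (\<phi> c)) + (\<Sum>c\<in>R - B x. \<mu> c * - ln (1 - \<phi> c)) + (W - 1) * ?K) / W"
      proof -
        have "sum \<mu> (R - B x) = W - 1"
          using finR BR[OF x] x psubset.prems by (simp add: sum_diff W_def finite_subset)
        then show ?thesis by (simp only: sum.distrib sum_distrib_right[symmetric] add.assoc)
      qed
      \<comment> \<open>The same fixed point for the cost. The two sums are at most
        \<open>?K\<close>, because enlarging \<open>R\<close> to \<open>C\<close> adds only
        nonnegative terms.\<close>
      also have "\<dots> \<le> (?K + (W - 1) * ?K) / W"
      proof -
        have "(\<Sum>c\<in>R - B x. \<mu> c * - ln (1 - \<phi> c)) \<le> (\<Sum>c\<in>C - B x. \<mu> c * - ln (1 - \<phi> c))"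
          using finC RC \<mu> \<phi> by (intro sum_mono2) (auto intro!: mult_nonneg_nonpos simp: less_imp_le)
        then show ?thesis using W by (intro divide_right_mono) (simp_all add: cell_cost_def)
      qed
      also have "\<dots> = ?K" using W by (simp add: field_simps)
      finally show ?thesis .
    qed
    ultimately show ?thesis by blast
  qed
qed

section \<open>Slices of a finite set of heights and estimates for their cost\<close>

text \<open>The lower end of the slice with upper end \<open>v\<close>. Inserting 0 lets the lowest
  slice start at 0 and keeps the maximum defined.\<close>

definition pred_in :: "real set \<Rightarrow> real \<Rightarrow> real" where
  "pred_in V v = Max (insert 0 {w \<in> V. w < v})"

lemma pred_in_nonneg: "finite V \<Longrightarrow> 0 \<le> pred_in V v"
  by (simp add: pred_in_def)

lemma pred_in_le: "finite V \<Longrightarrow> 0 \<le> v \<Longrightarrow> pred_in V v \<le> v"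
  by (auto simp: pred_in_def)

text \<open>Induction on the number of heights below \<open>p\<close>, since the predecessor of
  \<open>p\<close> is the next endpoint down. With the identity for \<open>G\<close> this gives the
  mass below \<open>p\<close>; with a bounded antiderivative it gives a tail bound.\<close>

lemma sum_pred_in_telescope:
  fixes G :: "real \<Rightarrow> real"
  assumes "finite V" "\<And>v. v \<in> V \<Longrightarrow> 0 \<le> v" "p \<in> V"
  shows "(\<Sum>v\<in>{v \<in> V. v \<le> p}. G v - G (pred_in V v)) = G p - G 0"
  using assms(3)
proof (induction "card {v \<in> V. v < p}" arbitrary: p rule: less_induct)
  case less
  have le: "{v \<in> V. v \<le> p} = insert p {v \<in> V. v < p}" using less.prems by auto
  show ?case
  proof (cases "{v \<in> V. v < p} = {}")
    case True
    then have "pred_in V p = 0" unfolding pred_in_def by (simp only: Max_singleton)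
    then show ?thesis unfolding le True by simp
  next
    case False
    define m where "m = Max {v \<in> V. v < p}"
    have fin: "finite {v \<in> V. v < p}" using assms(1) by simp
    have m: "m \<in> V" "m < p" using Max_in[OF fin False] by (auto simp: m_def)
    have m_ge: "v \<le> m" if "v \<in> V" "v < p" for v unfolding m_def using fin that by (intro Max_ge) auto
    have pred: "pred_in V p = m"
      unfolding pred_in_def using fin False m assms(2)[of m] by (simp add: m_def[symmetric])
    have lt: "{v \<in> V. v < p} = {v \<in> V. v \<le> m}" using m m_ge by force
    have "card {v \<in> V. v < m} < card {v \<in> V. v < p}"
      using m by (intro psubset_card_mono fin) auto
    then have "(\<Sum>v\<in>{v \<in> V. v \<le> m}. G v - G (pred_in V v)) = G m - G 0"
      using m by (intro less.hyps) auto
    then have "(\<Sum>v\<in>{v \<in> V. v < p}. G v - G (pred_in V v)) = G m - G 0" by (simp only: lt)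
    then show ?thesis unfolding le using assms(1) by (simp add: pred)
  qed
qed

text \<open>Compares an integral with a one-term Riemann sum: \<open>- (1 + r) powr - t\<close> has
  derivative \<open>t * (1 + r) powr - (1 + t)\<close>, which decreases and is taken at the right
  end. With s the ratio of the two bases, it follows from ln s <= s - 1 and exp r >= 1 + r.\<close>

lemma powr_tail_bound:
  fixes \<alpha> \<beta> t :: real
  assumes "0 \<le> \<alpha>" "\<alpha> \<le> \<beta>" "0 < t"
  shows "t * (\<beta> - \<alpha>) * (1 + \<beta>) powr - (1 + t) \<le> (1 + \<alpha>) powr - t - (1 + \<beta>) powr - t"
proof -
  define s where "s = (1 + \<alpha>) / (1 + \<beta>)"
  have s: "0 < s" using assms by (simp add: s_def)
  have "t * (1 - s) \<le> t * (- ln s)"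
    using ln_le_minus_one[OF s] assms by (intro mult_left_mono) auto
  also have "\<dots> \<le> s powr - t - 1"
    using s exp_ge_add_one_self[of "- t * ln s"] by (simp add: powr_def)
  finally have "t * (1 - s) * (1 + \<beta>) powr - t \<le> (s powr - t - 1) * (1 + \<beta>) powr - t"
    by (rule mult_right_mono) simp
  also have "\<dots> = (s * (1 + \<beta>)) powr - t - (1 + \<beta>) powr - t"
    using s assms by (simp add: powr_mult left_diff_distrib)
  also have "s * (1 + \<beta>) = 1 + \<alpha>" using assms by (simp add: s_def)
  also have "t * (1 - s) * (1 + \<beta>) powr - t = t * (\<beta> - \<alpha>) * (1 + \<beta>) powr - (1 + t)"
  proof -
    have "1 - s = (\<beta> - \<alpha>) / (1 + \<beta>)" using assms by (simp add: s_def field_simps)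
    moreover have "(1 + \<beta>) powr - t = (1 + \<beta>) * (1 + \<beta>) powr - (1 + t)"
      using assms powr_add[of "1 + \<beta>" 1 "- (1 + t)"] by simp
    ultimately show ?thesis using assms by simp
  qed
  finally show ?thesis .
qed

lemma neg_ln_one_minus_le:
  fixes s :: real
  assumes "0 \<le> s" "s \<le> 1 / 2"
  shows "- ln (1 - s) \<le> 2 * s"
proof -
  have "- ln (1 - s) = ln (1 / (1 - s))" using assms by (simp add: ln_div)
  also have "\<dots> \<le> 1 / (1 - s) - 1" using assms by (intro ln_le_minus_one) auto
  also have "\<dots> = s / (1 - s)" using assms by (simp add: field_simps)
  also have "\<dots> \<le> 2 * s"
  proof -
    have "s * (1 / (1 - s)) \<le> s * 2"
      using assms by (intro mult_left_mono) (auto simp: field_simps)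
    then show ?thesis by simp
  qed
  finally show ?thesis .
qed

text \<open>
  The cells over \<open>y\<close> are the intervals between consecutive values of \<open>\<kappa> x y\<close>, and \<open>x\<close> accepts those
  below \<open>\<kappa> x y\<close>. The stopping probability decays in the likelihood ratio \<open>\<rho> = v / q y\<close> like
  \<open>\<rho> powr - (1 + t)\<close>: the exponent is just large enough for the total stopping probability to be
  finite, and accepting at ratio \<open>\<rho>\<close> costs only \<open>(1 + t) * ln \<rho>\<close> up to constants.
\<close>

lemma kernel_coupling:
  fixes \<kappa> :: "'x \<Rightarrow> 'y::finite pmf" and q :: "'y \<Rightarrow> real" and t :: real
  assumes A: "finite A" and q: "\<And>y. 0 \<le> q y" "(\<Sum>y\<in>UNIV. q y) = 1"
    and dom: "\<And>x y. x \<in> A \<Longrightarrow> q y = 0 \<Longrightarrow> pmf (\<kappa> x) y = 0"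
    and t: "0 < t" "t \<le> 1"
  shows "\<exists>G :: (('x \<Rightarrow> 'y) \<times> ('y \<Rightarrow> real)) pmf. finite (set_pmf G) \<and>
    (\<forall>z\<in>set_pmf G. (\<forall>y. 0 \<le> snd z y) \<and> (\<Sum>y\<in>UNIV. snd z y) \<le> 1 \<and> (\<forall>x\<in>A. 0 < snd z (fst z x))) \<and>
    (\<forall>x\<in>A. map_pmf (\<lambda>z. fst z x) G = \<kappa> x) \<and>
    (\<forall>x\<in>A. measure_pmf.expectation G (\<lambda>z. - ln (snd z (fst z x))) \<le>
      ln (2 / t) + (1 + t) * (\<Sum>y\<in>UNIV. pmf (\<kappa> x) y * ln (1 + pmf (\<kappa> x) y / q y)) + 1)"
proof -
  define V where "V y = (\<lambda>x. pmf (\<kappa> x) y) ` A" for y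
  define C where "C = Sigma UNIV V"
  define \<mu> where "\<mu> c = snd c - pred_in (V (fst c)) (snd c)" for c
  \<comment> \<open>The factor \<open>t / 2\<close> keeps the stopping probability at most 1/2.
    There - ln (1 - s) <= 2 s, and this 2 restores the integrand of
    \<open>powr_tail_bound\<close>.\<close>
  define \<phi> where "\<phi> c = t / 2 * (1 + snd c / q (fst c)) powr - (1 + t)" for c
  define B where "B x = Sigma UNIV (\<lambda>y. {v \<in> V y. v \<le> pmf (\<kappa> x) y})" for x
  have finV: "finite (V y)" and V0: "v \<in> V y \<Longrightarrow> 0 \<le> v" for v y
    using A by (auto simp: V_def)
  have \<kappa>V: "pmf (\<kappa> x) y \<in> V y" if "x \<in> A" for x y using that by (auto simp: V_def)
  \<comment> \<open>Where \<open>q y\<close> vanishes, \<open>v / q y\<close> is 0 by convention.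
    This is harmless, as the only height there is 0 and its slice has no mass.\<close>
  have V_q0: "v = 0" if "v \<in> V y" "q y = 0" for v y using that dom by (auto simp: V_def)
  have finC: "finite C" using finV by (auto simp: C_def)
  have \<mu>: "0 \<le> \<mu> c" if "c \<in> C" for c
    using that pred_in_le[OF finV V0] by (auto simp: \<mu>_def C_def)
  have \<phi>_bounds: "0 < \<phi> c" "\<phi> c \<le> 1 / 2" if "c \<in> C" for c
  proof -
    have *: "1 \<le> 1 + snd c / q (fst c)" using that V0 q by (auto simp: C_def)
    then show "0 < \<phi> c" using t unfolding \<phi>_def by (intro mult_pos_pos) auto
    have "(1 + snd c / q (fst c)) powr - (1 + t) \<le> (1 + snd c / q (fst c)) powr 0"
      using * t by (intro powr_mono) auto
    then have "\<phi> c \<le> t / 2 * 1" using * t unfolding \<phi>_def by (intro mult_left_mono) auto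
    then show "\<phi> c \<le> 1 / 2" using t by simp
  qed
  have sum_\<mu>: "(\<Sum>v\<in>{v \<in> V y. v \<le> pmf (\<kappa> x) y}. \<mu> (y, v)) = pmf (\<kappa> x) y" if "x \<in> A" for x y
    using sum_pred_in_telescope[where V = "V y" and G = "\<lambda>v. v", OF finV V0 \<kappa>V[OF that]] by (simp add: \<mu>_def)
  have sum_B: "sum f (B x) = (\<Sum>y\<in>UNIV. \<Sum>v\<in>{v \<in> V y. v \<le> pmf (\<kappa> x) y}. f (y, v))" for f :: "_ \<Rightarrow> real" and x
    unfolding B_def using finV by (subst sum.Sigma) auto
  have BC: "B x \<subseteq> C" for x by (auto simp: B_def C_def)
  have one: "sum \<mu> (B x) = 1" if "x \<in> A" for x
    unfolding sum_B using that by (simp add: sum_\<mu> sum_pmf_eq_1)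
  have marginal: "sum \<mu> {c \<in> B x. fst c = y} = pmf (\<kappa> x) y" if "x \<in> A" for x y
  proof -
    have "{c \<in> B x. fst c = y} = Pair y ` {v \<in> V y. v \<le> pmf (\<kappa> x) y}" by (auto simp: B_def)
    then show ?thesis using sum_\<mu>[OF that] by (simp add: sum.reindex inj_on_def)
  qed
  have cost: "cell_cost \<mu> \<phi> C (B x) \<le>
      ln (2 / t) + (1 + t) * (\<Sum>y\<in>UNIV. pmf (\<kappa> x) y * ln (1 + pmf (\<kappa> x) y / q y)) + 1" if x: "x \<in> A" for x
  proof -
    have "(\<Sum>c\<in>B x. \<mu> c * - ln (\<phi> c)) =
        (\<Sum>y\<in>UNIV. \<Sum>v\<in>{v \<in> V y. v \<le> pmf (\<kappa> x) y}. \<mu> (y, v) * - ln (\<phi> (y, v)))"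
      by (rule sum_B)
    \<comment> \<open>Every accepted slice lies at a ratio at most that of \<open>x\<close> itself,
      where stopping is most expensive.\<close>
    also have "\<dots> \<le> (\<Sum>y\<in>UNIV. \<Sum>v\<in>{v \<in> V y. v \<le> pmf (\<kappa> x) y}. \<mu> (y, v) *
        (ln (2 / t) + (1 + t) * ln (1 + pmf (\<kappa> x) y / q y)))"
    proof (intro sum_mono mult_left_mono)
      fix y v assume v: "v \<in> {v \<in> V y. v \<le> pmf (\<kappa> x) y}"
      then have "0 \<le> v / q y" "v / q y \<le> pmf (\<kappa> x) y / q y"
        using V0 q by (auto intro!: divide_right_mono)
      then have le: "ln (1 + v / q y) \<le> ln (1 + pmf (\<kappa> x) y / q y)" and pos: "0 < 1 + v / q y" by auto
      have "- ln (\<phi> (y, v)) = ln (2 / t) + (1 + t) * ln (1 + v / q y)"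
        using pos t by (simp add: \<phi>_def ln_mult ln_powr ln_div algebra_simps)
      also have "\<dots> \<le> ln (2 / t) + (1 + t) * ln (1 + pmf (\<kappa> x) y / q y)"
        using le t by (intro add_left_mono mult_left_mono) auto
      finally show "- ln (\<phi> (y, v)) \<le> ln (2 / t) + (1 + t) * ln (1 + pmf (\<kappa> x) y / q y)" .
      show "0 \<le> \<mu> (y, v)" using v by (intro \<mu>) (auto simp: C_def)
    qed
    also have "\<dots> = (\<Sum>y\<in>UNIV. pmf (\<kappa> x) y * (ln (2 / t) + (1 + t) * ln (1 + pmf (\<kappa> x) y / q y)))"
      by (simp only: sum_distrib_right[symmetric] sum_\<mu>[OF x])
    also have "\<dots> = ln (2 / t) * (\<Sum>y\<in>UNIV. pmf (\<kappa> x) y) +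
        (1 + t) * (\<Sum>y\<in>UNIV. pmf (\<kappa> x) y * ln (1 + pmf (\<kappa> x) y / q y))"
      unfolding sum_distrib_left sum.distrib[symmetric] by (intro sum.cong refl) (simp add: algebra_simps)
    also have "(\<Sum>y\<in>UNIV. pmf (\<kappa> x) y) = 1" by (simp add: sum_pmf_eq_1)
    finally have 1: "(\<Sum>c\<in>B x. \<mu> c * - ln (\<phi> c)) \<le> ln (2 / t) * 1 +
        (1 + t) * (\<Sum>y\<in>UNIV. pmf (\<kappa> x) y * ln (1 + pmf (\<kappa> x) y / q y))" .
    \<comment> \<open>Up to the factor \<open>q y\<close>, the antiderivative from
      \<open>powr_tail_bound\<close>. Passing a cell costs at most its increment over the
      slice.\<close>
    let ?\<psi> = "\<lambda>y v. - q y * (1 + v / q y) powr - t"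
    have "(\<Sum>c\<in>C - B x. \<mu> c * - ln (1 - \<phi> c)) \<le> (\<Sum>c\<in>C - B x. \<mu> c * (2 * \<phi> c))"
      using \<phi>_bounds \<mu> by (intro sum_mono mult_left_mono neg_ln_one_minus_le) (auto simp: less_imp_le)
    also have "\<dots> \<le> (\<Sum>c\<in>C. \<mu> c * (2 * \<phi> c))"
      using finC \<mu> \<phi>_bounds by (intro sum_mono2) (auto simp: less_imp_le)
    also have "\<dots> = (\<Sum>y\<in>UNIV. \<Sum>v\<in>V y. \<mu> (y, v) * (2 * \<phi> (y, v)))"
      unfolding C_def using finV by (subst sum.Sigma) auto
    also have "\<dots> \<le> (\<Sum>y\<in>UNIV. \<Sum>v\<in>V y. ?\<psi> y v - ?\<psi> y (pred_in (V y) v))"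
    proof (intro sum_mono)
      fix y v assume v: "v \<in> V y"
      let ?u = "pred_in (V y) v"
      have u: "0 \<le> ?u" "?u \<le> v" using pred_in_nonneg[OF finV] pred_in_le[OF finV V0[OF v]] by auto
      show "\<mu> (y, v) * (2 * \<phi> (y, v)) \<le> ?\<psi> y v - ?\<psi> y ?u"
      proof (cases "q y = 0")
        case True
        then have "v = 0" using v V_q0 by simp
        then show ?thesis using u True by (simp add: \<mu>_def)
      next
        case False
        then have qy: "0 < q y" using q(1)[of y] by simp
        have "\<mu> (y, v) * (2 * \<phi> (y, v)) = q y * (t * (v / q y - ?u / q y) * (1 + v / q y) powr - (1 + t))"
          using qy by (simp add: \<mu>_def \<phi>_def field_simps)
        also have "\<dots> \<le> q y * ((1 + ?u / q y) powr - t - (1 + v / q y) powr - t)"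
          using qy u t by (intro mult_left_mono powr_tail_bound divide_right_mono) auto
        also have "\<dots> = ?\<psi> y v - ?\<psi> y ?u" by (simp add: algebra_simps)
        finally show ?thesis .
      qed
    qed
    \<comment> \<open>\<open>?\<psi> y\<close> starts at \<open>- q y\<close> and stays nonpositive,
      so its increments sum to at most \<open>q y\<close>, however many cells there are.\<close>
    also have "\<dots> \<le> (\<Sum>y\<in>UNIV. q y)"
    proof (intro sum_mono)
      fix y
      have ne: "V y \<noteq> {}" using x by (auto simp: V_def)
      have "{v \<in> V y. v \<le> Max (V y)} = V y" using finV by auto
      then have "(\<Sum>v\<in>V y. ?\<psi> y v - ?\<psi> y (pred_in (V y) v)) = ?\<psi> y (Max (V y)) - ?\<psi> y 0"
        using sum_pred_in_telescope[where V = "V y" and G = "?\<psi> y", OF finV V0 Max_in[OF finV ne]] by simp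
      also have "\<dots> \<le> q y" using q(1)[of y] by simp
      finally show "(\<Sum>v\<in>V y. ?\<psi> y v - ?\<psi> y (pred_in (V y) v)) \<le> q y" .
    qed
    finally have "(\<Sum>c\<in>C - B x. \<mu> c * - ln (1 - \<phi> c)) \<le> 1" using q by simp
    with 1 show ?thesis by (simp add: cell_cost_def)
  qed
  have \<phi>: "0 < \<phi> c" "\<phi> c < 1" if "c \<in> C" for c using \<phi>_bounds[OF that] by auto
  obtain G :: "(('x \<Rightarrow> 'y) \<times> ('y \<Rightarrow> real)) pmf" where
    1: "finite (set_pmf G)" and
    2: "\<forall>z\<in>set_pmf G. (\<forall>y. 0 \<le> snd z y) \<and> (\<Sum>y\<in>UNIV. snd z y) \<le> 1 \<and> (\<forall>x\<in>A. 0 < snd z (fst z x))" and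
    3: "\<forall>x\<in>A. \<forall>y. pmf (map_pmf (\<lambda>z. fst z x) G) y = sum \<mu> {c \<in> B x. fst c = y}" and
    4: "\<forall>x\<in>A. measure_pmf.expectation G (\<lambda>z. - ln (snd z (fst z x))) \<le> cell_cost \<mu> \<phi> C (B x)"
    by (atomize_elim, rule greedy_coupling[where lab = fst]) (use finC \<mu> \<phi> A BC one in blast)+
  show ?thesis
    by (intro exI[of _ G] conjI 1 2 ballI pmf_eqI) (use 3 4 marginal cost in force)+
qed

subsection \<open>A single pair\<close>

lemma pmf_joint_law: "pmf (joint_law p Q) (a, u) = pmf p a * pmf (Q a) u"
proof -
  have "pmf (map_pmf (Pair b) (Q b)) (a, u) = pmf (Q a) u * indicator {a} b" for b
  proof (cases "b = a")
    case True
    then show ?thesis by (simp add: pmf_map_inj' inj_def)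
  next
    case False
    then have "(a, u) \<notin> set_pmf (map_pmf (Pair b) (Q b))" by auto
    then have "pmf (map_pmf (Pair b) (Q b)) (a, u) = 0" by (simp only: set_pmf_iff not_not)
    then show ?thesis using False by simp
  qed
  then have "pmf (joint_law p Q) (a, u) = measure_pmf.expectation p (\<lambda>b. pmf (Q a) u * indicator {a} b)"
    by (simp add: joint_law_def pmf_bind)
  then show ?thesis by (simp add: measure_pmf_single)
qed

lemma map_fst_joint_law [simp]: "map_pmf fst (joint_law p Q) = p"
  by (simp add: joint_law_def map_bind_pmf map_pmf_comp map_pmf_const bind_return_pmf')

text \<open>On the support of the first marginal the kernel is the true conditional law; elsewhere
  it is arbitrary and gets weight 0.\<close>

lemma joint_law_disintegration:
  fixes L :: "('a \<times> 'b) pmf"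
  shows "joint_law (map_pmf fst L) (\<lambda>a. map_pmf snd (cond_pmf L (fst -` {a}))) = L"
proof (rule pmf_eqI)
  fix z :: "'a \<times> 'b"
  obtain a u where z: "z = (a, u)" by (cases z)
  let ?p = "map_pmf fst L" and ?Q = "\<lambda>a. map_pmf snd (cond_pmf L (fst -` {a}))"
  show "pmf (joint_law ?p ?Q) z = pmf L z"
  proof (cases "a \<in> set_pmf ?p")
    case True
    then have ne: "set_pmf L \<inter> fst -` {a} \<noteq> {}" by auto
    have pos: "pmf ?p a > 0" using True by (simp add: pmf_positive_iff)
    have "pmf (?Q a) u = measure_pmf.prob (cond_pmf L (fst -` {a})) (snd -` {u})"
      by (simp add: pmf_map)
    also have "\<dots> = measure_pmf.prob (cond_pmf L (fst -` {a})) {(a, u)}"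
      by (intro measure_prob_cong_0) (auto simp: pmf_cond[OF ne])
    also have "\<dots> = pmf L (a, u) / pmf ?p a"
      by (simp add: measure_pmf_single pmf_cond[OF ne] pmf_map)
    finally show ?thesis using pos by (simp add: z pmf_joint_law)
  next
    case False
    then have "z \<notin> set_pmf L" using z by force
    then have "pmf L z = 0" by (simp only: set_pmf_iff not_not)
    moreover have "pmf ?p a = 0" using False by (simp only: set_pmf_iff not_not)
    ultimately show ?thesis by (simp add: z pmf_joint_law)
  qed
qed

lemma expectation_pair_pmf_finite:
  fixes h :: "_ \<Rightarrow> real"
  assumes "finite (set_pmf p)" "finite (set_pmf q)"
  shows "measure_pmf.expectation (pair_pmf p q) h =
    measure_pmf.expectation p (\<lambda>x. measure_pmf.expectation q (\<lambda>y. h (x, y)))"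
proof -
  have "pair_pmf p q = bind_pmf p (\<lambda>x. map_pmf (Pair x) q)"
    by (simp add: pair_pmf_def map_pmf_def)
  then have "measure_pmf.expectation (pair_pmf p q) h =
      (\<Sum>x\<in>set_pmf p. pmf p x *\<^sub>R measure_pmf.expectation (map_pmf (Pair x) q) h)"
    using assms by (simp only:) (intro pmf_expectation_bind, auto)
  also have "\<dots> = measure_pmf.expectation p (\<lambda>x. measure_pmf.expectation q (\<lambda>y. h (x, y)))"
    using assms by (subst integral_measure_pmf[of "set_pmf p"]) auto
  finally show ?thesis .
qed

text \<open>The coupling is applied to the conditional laws of the second component, with its
  marginal as reference law. The mean log likelihood ratio is then the mutual information.\<close>

lemma functional_representation:
  fixes p :: "('x::finite \<times> 'y::finite) pmf"
  defines "I \<equiv> mutual_info p fst snd"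
  obtains G :: "(('x \<Rightarrow> 'y) \<times> ('y \<Rightarrow> real)) pmf" where
    "finite (set_pmf G)"
    "\<And>z y. z \<in> set_pmf G \<Longrightarrow> 0 \<le> snd z y"
    "\<And>z. z \<in> set_pmf G \<Longrightarrow> (\<Sum>y\<in>UNIV. snd z y) \<le> 1"
    "\<And>z x. z \<in> set_pmf G \<Longrightarrow> x \<in> fst ` set_pmf p \<Longrightarrow> 0 < snd z (fst z x)"
    "map_pmf (\<lambda>(x, z). (x, fst z x)) (pair_pmf (map_pmf fst p) G) = p"
    "measure_pmf.expectation (pair_pmf (map_pmf fst p) G) (\<lambda>(x, z). - ln (snd z (fst z x))) \<le> I + ln (I + 1) + 4"
proof -
  define pX where "pX = map_pmf fst p"
  define \<kappa> where "\<kappa> a = map_pmf snd (cond_pmf p (fst -` {a}))" for a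
  define q where "q y = pmf (map_pmf snd p) y" for y
  define t where "t = 1 / (I + 1)" \<comment> \<open>balances \<open>ln (1 / t)\<close> against \<open>t * I\<close> in the cost\<close>
  have I0: "0 \<le> I" unfolding I_def by (rule mutual_info_nonneg)
  have t: "0 < t" "t \<le> 1" using I0 by (auto simp: t_def)
  have p: "joint_law pX \<kappa> = p" unfolding pX_def \<kappa>_def by (rule joint_law_disintegration)
  have pmf_p: "pmf p (x, y) = pmf pX x * pmf (\<kappa> x) y" for x y
    by (subst p[symmetric], rule pmf_joint_law)
  have q1: "(\<Sum>y\<in>UNIV. q y) = 1" by (simp add: q_def sum_pmf_eq_1)
  have dom: "pmf (\<kappa> x) y = 0" if "x \<in> set_pmf pX" "q y = 0" for x y
  proof -
    have "pmf p (x, y) \<le> q y" unfolding q_def using pmf_le_pmf_map[of p "(x, y)" snd] by simp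
    then have "pmf p (x, y) = 0" using that(2) pmf_nonneg[of p "(x, y)"] by linarith
    then have "pmf pX x * pmf (\<kappa> x) y = 0" by (simp only: pmf_p)
    then show ?thesis using that(1) by (simp add: set_pmf_iff)
  qed
  obtain G :: "(('x \<Rightarrow> 'y) \<times> ('y \<Rightarrow> real)) pmf" where
    G1: "finite (set_pmf G)" and
    G2: "\<forall>z\<in>set_pmf G. (\<forall>y. 0 \<le> snd z y) \<and> (\<Sum>y\<in>UNIV. snd z y) \<le> 1 \<and>
      (\<forall>x\<in>set_pmf pX. 0 < snd z (fst z x))" and
    G3: "\<forall>x\<in>set_pmf pX. map_pmf (\<lambda>z. fst z x) G = \<kappa> x" and
    G4: "\<forall>x\<in>set_pmf pX. measure_pmf.expectation G (\<lambda>z. - ln (snd z (fst z x))) \<le>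
      ln (2 / t) + (1 + t) * (\<Sum>y\<in>UNIV. pmf (\<kappa> x) y * ln (1 + pmf (\<kappa> x) y / q y)) + 1"
    by (atomize_elim, rule kernel_coupling) (use q1 dom t in \<open>auto simp: q_def\<close>)
  have "map_pmf (\<lambda>(x, z). (x, fst z x)) (pair_pmf pX G) = bind_pmf pX (\<lambda>x. map_pmf (Pair x) (map_pmf (\<lambda>z. fst z x) G))"
    by (simp add: pair_pmf_def map_bind_pmf map_pmf_def bind_assoc_pmf bind_return_pmf)
  also have "\<dots> = joint_law pX \<kappa>"
    unfolding joint_law_def using G3 by (intro bind_pmf_cong) auto
  finally have law: "map_pmf (\<lambda>(x, z). (x, fst z x)) (pair_pmf pX G) = p" by (simp add: p)
  let ?r = "\<lambda>x y. pmf (\<kappa> x) y / q y"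
  \<comment> \<open>Replacing ln (1 + r) by ln r costs at most 1 / r. Under \<open>p\<close> the
    mean of 1 / r is at most 1, since dividing by r turns \<open>p\<close> into the product of its
    marginals.\<close>
  have bound: "(\<Sum>x\<in>set_pmf pX. \<Sum>y\<in>UNIV. pmf p (x, y) * ln (1 + ?r x y)) \<le> I + 1"
  proof -
    have "(\<Sum>x\<in>set_pmf pX. \<Sum>y\<in>UNIV. pmf p (x, y) * ln (1 + ?r x y)) \<le>
        (\<Sum>x\<in>set_pmf pX. \<Sum>y\<in>UNIV. pmf p (x, y) * ln (?r x y) + pmf pX x * q y)"
    proof (intro sum_mono)
      fix x y assume x: "x \<in> set_pmf pX"
      show "pmf p (x, y) * ln (1 + ?r x y) \<le> pmf p (x, y) * ln (?r x y) + pmf pX x * q y"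
      proof (cases "pmf p (x, y) = 0")
        case True
        then show ?thesis by (simp add: q_def)
      next
        case False
        then have \<kappa>: "pmf (\<kappa> x) y > 0" and pX: "pmf pX x > 0" unfolding pmf_p by (auto simp: less_le)
        then have q: "q y > 0" using dom[OF x, of y] by (auto simp: q_def less_le)
        have r: "?r x y > 0" using \<kappa> q by simp
        have "1 + ?r x y = ?r x y * (1 + 1 / ?r x y)"
          using \<kappa> q by (simp add: field_simps)
        then have "ln (1 + ?r x y) = ln (?r x y * (1 + 1 / ?r x y))" by (rule arg_cong)
        also have "\<dots> = ln (?r x y) + ln (1 + 1 / ?r x y)"
          using \<kappa> q by (intro ln_mult_pos add_pos_pos divide_pos_pos) auto
        also have "ln (1 + 1 / ?r x y) \<le> 1 / ?r x y"
          using \<kappa> q by (intro ln_add_one_self_le_self) auto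
        finally have "pmf p (x, y) * ln (1 + ?r x y) \<le> pmf p (x, y) * (ln (?r x y) + 1 / ?r x y)"
          by (intro mult_left_mono) auto
        also have "\<dots> = pmf p (x, y) * ln (?r x y) + pmf pX x * q y"
          using \<kappa> q by (simp add: pmf_p field_simps)
        finally show ?thesis .
      qed
    qed
    also have "\<dots> = (\<Sum>x\<in>set_pmf pX. \<Sum>y\<in>UNIV. pmf p (x, y) * ln (?r x y)) + 1"
      by (simp add: sum.distrib sum_distrib_left[symmetric] q1 sum_pmf_eq_1)
    also have "(\<Sum>x\<in>set_pmf pX. \<Sum>y\<in>UNIV. pmf p (x, y) * ln (?r x y)) =
        (\<Sum>z\<in>set_pmf pX \<times> UNIV. pmf p z * ln (pmf p z / (pmf pX (fst z) * q (snd z))))"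
      by (subst sum.cartesian_product) (intro sum.cong refl, auto simp: pmf_p set_pmf_iff)
    also have "\<dots> = I"
      unfolding I_def mutual_info_eq_info info_def
      by (subst integral_measure_pmf_real[of "set_pmf pX \<times> UNIV"])
        (auto simp: pX_def q_def map_pmf_comp mult.commute intro!: image_eqI)
    finally show ?thesis by simp
  qed
  have "measure_pmf.expectation (pair_pmf pX G) (\<lambda>(x, z). - ln (snd z (fst z x))) =
      (\<Sum>x\<in>set_pmf pX. measure_pmf.expectation G (\<lambda>z. - ln (snd z (fst z x))) * pmf pX x)"
    unfolding expectation_pair_pmf_finite[OF finite G1] prod.case
    by (intro integral_measure_pmf_real) auto
  also have "\<dots> \<le> (\<Sum>x\<in>set_pmf pX.
      (ln (2 / t) + (1 + t) * (\<Sum>y\<in>UNIV. pmf (\<kappa> x) y * ln (1 + ?r x y)) + 1) * pmf pX x)"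
    using G4 by (intro sum_mono mult_right_mono) auto
  also have "\<dots> = (ln (2 / t) + 1) * (\<Sum>x\<in>set_pmf pX. pmf pX x) +
      (1 + t) * (\<Sum>x\<in>set_pmf pX. \<Sum>y\<in>UNIV. pmf p (x, y) * ln (1 + ?r x y))"
    unfolding pmf_p sum_distrib_left sum_distrib_right sum.distrib[symmetric]
    by (intro sum.cong refl) (simp add: sum_distrib_left sum_distrib_right algebra_simps)
  also have "(\<Sum>x\<in>set_pmf pX. pmf pX x) = 1" by (simp add: sum_pmf_eq_1)
  also have "(ln (2 / t) + 1) * 1 + (1 + t) * (\<Sum>x\<in>set_pmf pX. \<Sum>y\<in>UNIV. pmf p (x, y) * ln (1 + ?r x y)) \<le>
      (ln (2 / t) + 1) * 1 + (1 + t) * (I + 1)"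
    using bound t by (intro add_left_mono mult_left_mono) auto
  \<comment> \<open>The choice of \<open>t\<close> gives \<open>(1 + t) * (I + 1) = I + 2\<close>.
    The constants add up to 3 + ln 2, which is below 4.\<close>
  also have "(ln (2 / t) + 1) * 1 + (1 + t) * (I + 1) = ln 2 + ln (I + 1) + 1 + (I + 2)"
  proof -
    have "ln (2 / t) = ln (2 * (I + 1))" by (simp add: t_def)
    also have "\<dots> = ln 2 + ln (I + 1)" using I0 by (intro ln_mult_pos) auto
    finally show ?thesis using I0 by (simp add: t_def field_simps)
  qed
  also have "\<dots> \<le> I + ln (I + 1) + 4"
    using ln_2_less_1 by simp
  finally have cost: "measure_pmf.expectation (pair_pmf pX G) (\<lambda>(x, z). - ln (snd z (fst z x))) \<le> I + ln (I + 1) + 4"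
    .
  show ?thesis
    using that[of G] G1 G2 law cost unfolding pX_def by auto
qed

text \<open>An erasure channel: the noise and the coin are independent of \<open>X\<close>, so the
  information density is - ln of the probability of \<open>X\<close> when the coin reveals it and 0
  otherwise. \<open>enc\<close> merely renames outcomes.\<close>

lemma mutual_info_erasure:
  fixes pX :: "'x::finite pmf" and enc :: "'v \<times> 'x option \<Rightarrow> 'b::countable"
  assumes fin: "finite (set_pmf G)" and inj: "inj_on enc (set_pmf G \<times> UNIV)"
    and \<alpha>: "0 \<le> \<alpha>" "\<alpha> \<le> 1"
  shows "mutual_info (pair_pmf (pair_pmf pX G) (bernoulli_pmf \<alpha>)) (\<lambda>\<omega>. fst (fst \<omega>))
      (\<lambda>\<omega>. enc (snd (fst \<omega>), if snd \<omega> then Some (fst (fst \<omega>)) else None)) =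
    \<alpha> * mutual_info pX (\<lambda>x. x) (\<lambda>x. x)"
proof -
  let ?\<Omega> = "pair_pmf (pair_pmf pX G) (bernoulli_pmf \<alpha>)"
  let ?X = "\<lambda>\<omega> :: ('x \<times> 'v) \<times> bool. fst (fst \<omega>)"
  let ?Z = "\<lambda>\<omega> :: ('x \<times> 'v) \<times> bool. snd (fst \<omega>)"
  let ?U = "\<lambda>\<omega>. enc (?Z \<omega>, if snd \<omega> then Some (?X \<omega>) else None)"
  let ?J = "map_pmf (\<lambda>\<omega>. (?X \<omega>, ?U \<omega>)) ?\<Omega>"
  have X: "map_pmf ?X ?\<Omega> = pX"
    using map_pmf_comp[of fst fst ?\<Omega>] by (simp add: map_fst_pair_pmf)
  have U_eq: "?U \<omega>' = ?U \<omega> \<longleftrightarrow> ?Z \<omega>' = ?Z \<omega> \<and> snd \<omega>' = snd \<omega> \<and> (snd \<omega> \<longrightarrow> ?X \<omega>' = ?X \<omega>)"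
    if "\<omega> \<in> set_pmf ?\<Omega>" "\<omega>' \<in> set_pmf ?\<Omega>" for \<omega> \<omega>'
    using that by (subst inj_on_eq_iff[OF inj]) (auto simp: mem_Times_iff)
  have ratio: "ln (pmf ?J (?X \<omega>, ?U \<omega>) / (pmf pX (?X \<omega>) * pmf (map_pmf ?U ?\<Omega>) (?U \<omega>))) =
      (if snd \<omega> then - ln (pmf pX (?X \<omega>)) else 0)" if \<omega>: "\<omega> \<in> set_pmf ?\<Omega>" for \<omega>
  proof -
    have pos: "pmf (map_pmf ?U ?\<Omega>) (?U \<omega>) > 0" "pmf pX (?X \<omega>) > 0"
      using \<omega> by (auto simp: pmf_positive_iff)
    show ?thesis
    proof (cases "snd \<omega>")
      case True
      have "pmf ?J (?X \<omega>, ?U \<omega>) = pmf (map_pmf ?U ?\<Omega>) (?U \<omega>)"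
        unfolding pmf_map
      proof (rule measure_prob_cong_0)
        fix \<omega>' assume "\<omega>' \<in> ?U -` {?U \<omega>} - (\<lambda>\<omega>. (?X \<omega>, ?U \<omega>)) -` {(?X \<omega>, ?U \<omega>)}"
        then have "?U \<omega>' = ?U \<omega>" "?X \<omega>' \<noteq> ?X \<omega>" by auto
        then have "\<omega>' \<notin> set_pmf ?\<Omega>" using U_eq[OF \<omega>, of \<omega>'] True by blast
        then show "pmf ?\<Omega> \<omega>' = 0" by (simp only: set_pmf_iff not_not)
      qed auto
      then show ?thesis using pos True by (simp add: ln_div ln_mult)
    next
      case False
      have "pmf (map_pmf ?U ?\<Omega>) (?U \<omega>) = pmf (map_pmf (\<lambda>\<omega>. (?Z \<omega>, snd \<omega>)) ?\<Omega>) (?Z \<omega>, False)"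
        unfolding pmf_map
      proof (rule measure_prob_cong_0)
        fix \<omega>' assume "\<omega>' \<in> ?U -` {?U \<omega>} - (\<lambda>\<omega>. (?Z \<omega>, snd \<omega>)) -` {(?Z \<omega>, False)}"
        then have "\<omega>' \<notin> set_pmf ?\<Omega>" using U_eq[OF \<omega>, of \<omega>'] False by auto
        then show "pmf ?\<Omega> \<omega>' = 0" by (simp only: set_pmf_iff not_not)
      qed (use False in auto)
      also have "map_pmf (\<lambda>\<omega>. (?Z \<omega>, snd \<omega>)) ?\<Omega> = pair_pmf G (bernoulli_pmf \<alpha>)"
        using map_pair[of snd id "pair_pmf pX G" "bernoulli_pmf \<alpha>"]
        by (simp add: map_snd_pair_pmf case_prod_unfold id_def[symmetric])
      finally have 1: "pmf (map_pmf ?U ?\<Omega>) (?U \<omega>) = pmf G (?Z \<omega>) * pmf (bernoulli_pmf \<alpha>) False"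
        by (simp add: pmf_pair)
      \<comment> \<open>Without the reveal, \<open>?X\<close> and \<open>?U\<close> together
        determine the whole sample point, whose mass is a product.\<close>
      have "pmf ?J (?X \<omega>, ?U \<omega>) = measure_pmf.prob ?\<Omega> {\<omega>}"
        unfolding pmf_map
      proof (rule measure_prob_cong_0)
        fix \<omega>' assume "\<omega>' \<in> (\<lambda>\<omega>. (?X \<omega>, ?U \<omega>)) -` {(?X \<omega>, ?U \<omega>)} - {\<omega>}"
        then have "\<omega>' \<notin> set_pmf ?\<Omega>" using U_eq[OF \<omega>, of \<omega>'] False by (auto simp: prod_eq_iff)
        then show "pmf ?\<Omega> \<omega>' = 0" by (simp only: set_pmf_iff not_not)
      qed auto
      also have "\<dots> = pmf ?\<Omega> \<omega>" by (rule measure_pmf_single)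
      also have "\<dots> = pmf pX (?X \<omega>) * pmf G (?Z \<omega>) * pmf (bernoulli_pmf \<alpha>) False"
        using False by (cases \<omega>; cases "fst \<omega>") (simp add: pmf_pair)
      finally have "pmf ?J (?X \<omega>, ?U \<omega>) = pmf pX (?X \<omega>) * pmf (map_pmf ?U ?\<Omega>) (?U \<omega>)"
        by (simp add: 1)
      then show ?thesis using pos False by simp
    qed
  qed
  have "mutual_info ?\<Omega> ?X ?U = measure_pmf.expectation ?\<Omega>
      (\<lambda>\<omega>. ln (pmf ?J (?X \<omega>, ?U \<omega>) / (pmf pX (?X \<omega>) * pmf (map_pmf ?U ?\<Omega>) (?U \<omega>))))"
    unfolding mutual_info_eq_info info_def by (simp add: map_pmf_comp X)
  also have "\<dots> = measure_pmf.expectation ?\<Omega> (\<lambda>\<omega>. if snd \<omega> then - ln (pmf pX (?X \<omega>)) else 0)"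
    by (intro integral_cong_AE) (simp_all add: AE_measure_pmf_iff ratio del: set_pair_pmf)
  also have "\<dots> = measure_pmf.expectation (map_pmf (\<lambda>\<omega>. (?X \<omega>, snd \<omega>)) ?\<Omega>)
      (\<lambda>(x, b). if b then - ln (pmf pX x) else 0)"
    by simp
  also have "map_pmf (\<lambda>\<omega>. (?X \<omega>, snd \<omega>)) ?\<Omega> = pair_pmf pX (bernoulli_pmf \<alpha>)"
    using map_pair[of fst id "pair_pmf pX G" "bernoulli_pmf \<alpha>"]
    by (simp add: map_fst_pair_pmf case_prod_unfold id_def[symmetric])
  also have "measure_pmf.expectation (pair_pmf pX (bernoulli_pmf \<alpha>)) (\<lambda>(x, b). if b then - ln (pmf pX x) else 0) =
      measure_pmf.expectation pX (\<lambda>x. \<alpha> * - ln (pmf pX x))"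
    unfolding expectation_pair_pmf_finite[OF finite finite] using \<alpha> by simp
  also have "\<dots> = \<alpha> * mutual_info pX (\<lambda>x. x) (\<lambda>x. x)"
    unfolding mutual_info_self_eq by simp
  finally show ?thesis .
qed

text \<open>The released number encodes the random function with its weight, plus \<open>X\<close>
  if a coin of bias \<alpha> says so. The coin tunes the leakage exactly, while both utility bounds
  decode only the function and its weight and so hold for every \<alpha>.\<close>

lemma single_letter:
  fixes p :: "('x::finite \<times> 'y::finite) pmf" and \<alpha> :: real
  assumes \<alpha>: "0 \<le> \<alpha>" "\<alpha> \<le> 1"
  defines "I \<equiv> mutual_info p fst snd"
  shows "\<exists>L :: (('x \<times> 'y) \<times> nat) pmf. finite (set_pmf L) \<and> map_pmf fst L = p \<and>
    mutual_info L (\<lambda>z. fst (fst z)) snd = \<alpha> * mutual_info p fst fst \<and>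
    mutual_info p snd snd - (I + ln (I + 1) + 4) \<le> mutual_info L (\<lambda>z. snd (fst z)) snd \<and>
    mutual_info p snd snd - mutual_info p fst fst \<le> mutual_info L (\<lambda>z. snd (fst z)) snd"
proof -
  obtain G :: "(('x \<Rightarrow> 'y) \<times> ('y \<Rightarrow> real)) pmf" where
    fin: "finite (set_pmf G)" and
    w0: "\<And>z y. z \<in> set_pmf G \<Longrightarrow> 0 \<le> snd z y" and
    w1: "\<And>z. z \<in> set_pmf G \<Longrightarrow> (\<Sum>y\<in>UNIV. snd z y) \<le> 1" and
    wpos: "\<And>z x. z \<in> set_pmf G \<Longrightarrow> x \<in> fst ` set_pmf p \<Longrightarrow> 0 < snd z (fst z x)" and
    law: "map_pmf (\<lambda>(x, z). (x, fst z x)) (pair_pmf (map_pmf fst p) G) = p" and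
    cost: "measure_pmf.expectation (pair_pmf (map_pmf fst p) G) (\<lambda>(x, z). - ln (snd z (fst z x))) \<le> I + ln (I + 1) + 4"
    by (rule functional_representation[of p, folded I_def], rule that)
  define pX where "pX = map_pmf fst p"
  define \<Omega> where "\<Omega> = pair_pmf (pair_pmf pX G) (bernoulli_pmf \<alpha>)"
  define E where "E = set_pmf G \<times> (UNIV :: 'x option set)"
  define U where "U \<omega> = to_nat_on E (snd (fst \<omega>), if snd \<omega> then Some (fst (fst \<omega>)) else None)"
    for \<omega> :: "('x \<times> ('x \<Rightarrow> 'y) \<times> ('y \<Rightarrow> real)) \<times> bool"
  define X where "X \<omega> = fst (fst \<omega>)" for \<omega> :: "('x \<times> ('x \<Rightarrow> 'y) \<times> ('y \<Rightarrow> real)) \<times> bool"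
  define Z where "Z \<omega> = snd (fst \<omega>)" for \<omega> :: "('x \<times> ('x \<Rightarrow> 'y) \<times> ('y \<Rightarrow> real)) \<times> bool"
  define Y where "Y \<omega> = fst (Z \<omega>) (X \<omega>)" for \<omega>
  \<comment> \<open>Recovers the coupling from the released number, whether or not \<open>X\<close>
    was revealed.\<close>
  define dec where "dec u = fst (from_nat_into E u)" for u
  have finE: "finite E" using fin by (simp add: E_def)
  have fin\<Omega>: "finite (set_pmf \<Omega>)" using fin by (simp add: \<Omega>_def)
  have map_fst_\<Omega>: "map_pmf fst \<Omega> = pair_pmf pX G" by (simp add: \<Omega>_def map_fst_pair_pmf)
  have \<Omega>D: "X \<omega> \<in> set_pmf pX" "Z \<omega> \<in> set_pmf G" if "\<omega> \<in> set_pmf \<Omega>" for \<omega>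
    using that by (auto simp: \<Omega>_def X_def Z_def)
  have dec: "dec (U \<omega>) = Z \<omega>" if "\<omega> \<in> set_pmf \<Omega>" for \<omega>
    using \<Omega>D[OF that] finE by (simp add: dec_def U_def E_def Z_def countable_finite)
  have XY: "map_pmf (\<lambda>\<omega>. (X \<omega>, Y \<omega>)) \<Omega> = p"
  proof -
    have "map_pmf (\<lambda>\<omega>. (X \<omega>, Y \<omega>)) \<Omega> = map_pmf (\<lambda>(x, z). (x, fst z x)) (map_pmf fst \<Omega>)"
      by (simp add: map_pmf_comp X_def Y_def Z_def case_prod_unfold)
    then show ?thesis by (simp add: map_fst_\<Omega> law pX_def)
  qed
  have HY: "mutual_info \<Omega> Y Y = mutual_info p snd snd" and HX: "mutual_info \<Omega> X X = mutual_info p fst fst"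
    by (simp_all add: XY[symmetric] mutual_info_map)
  have lawX: "map_pmf X \<Omega> = pX" unfolding pX_def by (subst XY[symmetric]) (simp add: map_pmf_comp)
  let ?L = "map_pmf (\<lambda>\<omega>. ((X \<omega>, Y \<omega>), U \<omega>)) \<Omega>"
  have "finite (set_pmf ?L)" using fin\<Omega> by simp
  moreover have "map_pmf fst ?L = p" by (simp add: map_pmf_comp XY)
  moreover have "mutual_info ?L (\<lambda>z. fst (fst z)) snd = \<alpha> * mutual_info p fst fst"
  proof -
    have "inj_on (to_nat_on E) (set_pmf G \<times> UNIV)"
      using inj_on_to_nat_on[OF countable_finite[OF finE]] by (simp add: E_def)
    from mutual_info_erasure[OF fin this \<alpha>, of pX]
    have "mutual_info \<Omega> X U = \<alpha> * mutual_info pX (\<lambda>x. x) (\<lambda>x. x)"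
      by (simp add: \<Omega>_def X_def[abs_def] U_def[abs_def])
    also have "mutual_info pX (\<lambda>x. x) (\<lambda>x. x) = mutual_info p fst fst"
      by (simp add: pX_def mutual_info_map)
    finally show ?thesis by (simp add: mutual_info_map)
  qed
  moreover have "mutual_info p snd snd - (I + ln (I + 1) + 4) \<le> mutual_info ?L (\<lambda>z. snd (fst z)) snd"
  proof -
    \<comment> \<open>Here the guess in Gibbs' inequality is the weight that comes with the
      coupling.\<close>
    have "mutual_info \<Omega> Y Y - measure_pmf.expectation \<Omega> (\<lambda>\<omega>. - ln (snd (dec (U \<omega>)) (Y \<omega>))) \<le> mutual_info \<Omega> Y U"
    proof (rule mutual_info_ge_cross_entropy[where w = "\<lambda>u. snd (dec u)", OF fin\<Omega>])
      fix \<omega> assume \<omega>: "\<omega> \<in> set_pmf \<Omega>"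
      show "0 < snd (dec (U \<omega>)) (Y \<omega>)"
        using wpos[OF \<Omega>D(2)[OF \<omega>], of "X \<omega>"] \<Omega>D(1)[OF \<omega>] dec[OF \<omega>] by (simp add: Y_def pX_def)
    next
      fix u y assume "u \<in> U ` set_pmf \<Omega>"
      then have "dec u \<in> set_pmf G" using \<Omega>D(2) dec by force
      then show "0 \<le> snd (dec u) y" "(\<Sum>y\<in>UNIV. snd (dec u) y) \<le> 1" by (rule w0, rule w1)
    qed
    also have "measure_pmf.expectation \<Omega> (\<lambda>\<omega>. - ln (snd (dec (U \<omega>)) (Y \<omega>))) =
        measure_pmf.expectation \<Omega> (\<lambda>\<omega>. - ln (snd (Z \<omega>) (Y \<omega>)))"
      by (intro integral_cong_AE) (simp_all add: AE_measure_pmf_iff dec)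
    also have "\<dots> = measure_pmf.expectation (map_pmf fst \<Omega>) (\<lambda>(x, z). - ln (snd z (fst z x)))"
      by (simp add: Y_def X_def Z_def case_prod_unfold)
    finally show ?thesis using cost by (simp add: map_fst_\<Omega> pX_def HY mutual_info_map)
  qed
  moreover have "mutual_info p snd snd - mutual_info p fst fst \<le> mutual_info ?L (\<lambda>z. snd (fst z)) snd"
  proof -
    \<comment> \<open>the true posterior of \<open>Y\<close> given the coupling, at least the mass of the single point \<open>X\<close>\<close>
    let ?w = "\<lambda>u y. \<Sum>x | fst (dec u) x = y. pmf pX x"
    have le: "pmf pX (X \<omega>) \<le> ?w (U \<omega>) (Y \<omega>)" if "\<omega> \<in> set_pmf \<Omega>" for \<omega>
      using dec[OF that] by (intro member_le_sum) (auto simp: Y_def)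
    have pos: "pmf pX (X \<omega>) > 0" if "\<omega> \<in> set_pmf \<Omega>" for \<omega>
      using \<Omega>D[OF that] by (simp add: pmf_positive_iff)
    have "mutual_info \<Omega> Y Y - measure_pmf.expectation \<Omega> (\<lambda>\<omega>. - ln (?w (U \<omega>) (Y \<omega>))) \<le> mutual_info \<Omega> Y U"
    proof (rule mutual_info_ge_cross_entropy[where w = ?w, OF fin\<Omega>])
      fix \<omega> assume "\<omega> \<in> set_pmf \<Omega>"
      then show "0 < ?w (U \<omega>) (Y \<omega>)" using le pos by (meson less_le_trans)
    next
      fix u
      have "(\<Sum>y\<in>UNIV. ?w u y) = (\<Sum>x\<in>UNIV. pmf pX x)"
        using sum.group[of UNIV UNIV "fst (dec u)" "pmf pX"] by simp
      then show "(\<Sum>y\<in>UNIV. ?w u y) \<le> 1" by (simp add: sum_pmf_eq_1)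
    qed (auto intro: sum_nonneg)
    moreover have "measure_pmf.expectation \<Omega> (\<lambda>\<omega>. - ln (?w (U \<omega>) (Y \<omega>))) \<le>
        measure_pmf.expectation \<Omega> (\<lambda>\<omega>. - ln (pmf pX (X \<omega>)))"
    proof (intro integral_mono_AE integrable_measure_pmf_finite fin\<Omega>, unfold AE_measure_pmf_iff, intro ballI)
      fix \<omega> assume \<omega>: "\<omega> \<in> set_pmf \<Omega>"
      show "- ln (?w (U \<omega>) (Y \<omega>)) \<le> - ln (pmf pX (X \<omega>))"
        using le[OF \<omega>] pos[OF \<omega>] by simp
    qed
    moreover have "measure_pmf.expectation \<Omega> (\<lambda>\<omega>. - ln (pmf pX (X \<omega>))) = mutual_info p fst fst"
      using mutual_info_self_eq[of \<Omega> X] by (simp add: HX lawX)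
    ultimately show ?thesis by (simp add: HY mutual_info_map)
  qed
  ultimately show ?thesis by blast
qed

subsection \<open>Independent pairs\<close>

lemma independent_pairs_eq_Pi_pmf:
  assumes "independent_pairs P"
  shows "P = map_pmf (\<lambda>\<omega>. (\<lambda>j. fst (\<omega> j), \<lambda>j. snd (\<omega> j)))
    (Pi_pmf UNIV d (\<lambda>j. map_pmf (\<lambda>(x, y). (x j, y j)) P))"
proof (rule pmf_eqI)
  fix z :: "('a \<Rightarrow> 'b) \<times> ('a \<Rightarrow> 'c)"
  obtain x y where z: "z = (x, y)" by (cases z)
  show "pmf P z = pmf (map_pmf (\<lambda>\<omega>. (\<lambda>j. fst (\<omega> j), \<lambda>j. snd (\<omega> j)))
      (Pi_pmf UNIV d (\<lambda>j. map_pmf (\<lambda>(x, y). (x j, y j)) P))) z"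
    using assms unfolding z pmf_map_Pair_Pi_pmf_UNIV[where f = "\<lambda>_. fst" and g = "\<lambda>_. snd"]
      independent_pairs_def by simp
qed

text \<open>Numerator and denominator of the conditional probability are both product events, and
  each quotient of factors is the conditional probability of one coordinate.\<close>

lemma cond_factorizes_Pi_pmf:
  fixes L :: "'n::finite \<Rightarrow> (('x \<times> 'y) \<times> 'v) pmf"
  shows "cond_factorizes (map_pmf (\<lambda>\<omega>. ((\<lambda>j. fst (fst (\<omega> j)), \<lambda>j. snd (fst (\<omega> j))), \<lambda>j. snd (\<omega> j)))
    (Pi_pmf UNIV d L))"
    (is "cond_factorizes ?R")
  unfolding cond_factorizes_def
proof (intro allI impI)
  fix y :: "'n \<Rightarrow> 'y" and u :: "'n \<Rightarrow> 'v"
  let ?M = "Pi_pmf UNIV d L"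
  let ?E = "\<lambda>j. {z. snd z = u j \<and> snd (fst z) = y j}" and ?F = "\<lambda>j. {z. snd (fst z) = y j}"
  have component: "measure_pmf.prob ?M {\<omega>. \<omega> j \<in> A} = measure_pmf.prob (L j) A" for j A
  proof -
    have "map_pmf (\<lambda>\<omega>. \<omega> j) ?M = L j" by (simp add: Pi_pmf_component)
    then have "measure_pmf.prob (L j) A = measure_pmf.prob (map_pmf (\<lambda>\<omega>. \<omega> j) ?M) A" by simp
    then show ?thesis by (simp add: vimage_def)
  qed
  have "\<P>(((x', y'), u') in measure_pmf ?R. u' = u \<bar> y' = y) =
      measure_pmf.prob ?M {\<omega>. \<forall>j. \<omega> j \<in> ?E j} / measure_pmf.prob ?M {\<omega>. \<forall>j. \<omega> j \<in> ?F j}"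
    unfolding cond_prob_def
    by (simp add: vimage_def case_prod_unfold fun_eq_iff all_conj_distrib)
  also have "\<dots> = (\<Prod>j\<in>UNIV. measure_pmf.prob (L j) (?E j) / measure_pmf.prob (L j) (?F j))"
    unfolding prob_Pi_pmf_UNIV prod_dividef ..
  also have "\<dots> = (\<Prod>j\<in>UNIV. \<P>(((x', y'), u') in measure_pmf ?R. u' j = u j \<bar> y' j = y j))"
    unfolding cond_prob_def component[symmetric]
    by (simp add: vimage_def case_prod_unfold)
  finally show "\<P>(((x', y'), u') in measure_pmf ?R. u' = u \<bar> y' = y) =
      (\<Prod>j\<in>UNIV. \<P>(((x', y'), u') in measure_pmf ?R. u' j = u j \<bar> y' j = y j))" .
qed

lemma restrict_eq_if: "restrict y S = (\<lambda>j. if j \<in> S then y j else undefined)"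
  by (simp add: restrict_def)

theorem theorem1:
  fixes P :: "(('n::finite \<Rightarrow> 'x::finite) \<times> ('n \<Rightarrow> 'y::finite)) pmf"
    and K :: nat and S :: "nat \<Rightarrow> 'n set" and \<epsilon> :: real
    and Q :: "('n \<Rightarrow> 'x) \<times> ('n \<Rightarrow> 'y) \<Rightarrow> 'u::countable pmf"
  assumes "independent_pairs P"
    and "K \<ge> 1"
    and "0 \<le> \<epsilon>" and "\<epsilon> < mutual_info P fst snd"
    and "mutual_info (joint_law P Q) (\<lambda>((x, y), u). x) (\<lambda>((x, y), u). u) \<le> \<epsilon>"
  shows "(\<exists>Qs :: ('n \<Rightarrow> 'x) \<times> ('n \<Rightarrow> 'y) \<Rightarrow> ('n \<Rightarrow> nat) pmf.
      cond_factorizes (joint_law P Qs) \<and>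
      mutual_info (joint_law P Qs) (\<lambda>((x, y), u). x) (\<lambda>((x, y), u). u) =
        mutual_info (joint_law P Q) (\<lambda>((x, y), u). x) (\<lambda>((x, y), u). u) \<and>
      (\<forall>k\<in>{1..K}.
        mutual_info (joint_law P Q) (\<lambda>((x, y), u). restrict y (S k)) (\<lambda>((x, y), u). u) \<le>
        mutual_info (joint_law P Qs) (\<lambda>((x, y), u). restrict y (S k)) (\<lambda>((x, y), u). u) +
          min (Delta1 P (S k)) (Delta2 P (S k)))) \<and>
    (\<forall>k\<in>{1..K}.
      Delta1 P (S k) =
        (\<Sum>j\<in>S k. mutual_info P (\<lambda>(x, y). x j) (\<lambda>(x, y). y j) +
                  cond_ent P (\<lambda>(x, y). x j) (\<lambda>(x, y). y j)) \<and>
      Delta2 P (S k) =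
        (\<Sum>j\<in>S k. mutual_info P (\<lambda>(x, y). x j) (\<lambda>(x, y). y j) +
                  (ln (mutual_info P (\<lambda>(x, y). x j) (\<lambda>(x, y). y j) + 1) + 4)))"
proof -
  define p where "p j = map_pmf (\<lambda>(x, y). (x j, y j)) P" for j
  define I where "I j = mutual_info (p j) fst snd" for j
  define HX where "HX j = mutual_info (p j) fst fst" for j
  define HY where "HY j = mutual_info (p j) snd snd" for j
  define \<delta> where "\<delta> = mutual_info (joint_law P Q) (\<lambda>((x, y), u). x) (\<lambda>((x, y), u). u)"
  \<comment> \<open>Each coordinate will leak \<open>\<alpha> * HX j\<close>, which sums to
    \<open>\<delta>\<close>. This is a probability because \<open>\<delta>\<close> is at most
    \<epsilon>, which is below I(X;Y) and hence below the positive entropy of X.\<close>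
  define \<alpha> where "\<alpha> = \<delta> / (\<Sum>j\<in>UNIV. HX j)"
  have P: "P = map_pmf (\<lambda>\<omega>. (\<lambda>j. fst (\<omega> j), \<lambda>j. snd (\<omega> j))) (Pi_pmf UNIV undefined p)"
    unfolding p_def by (rule independent_pairs_eq_Pi_pmf[OF assms(1)])
  have additive: "mutual_info P (\<lambda>z j. f j (fst z j, snd z j)) (\<lambda>z j. g j (fst z j, snd z j)) =
      (\<Sum>j\<in>UNIV. mutual_info (p j) (f j) (g j))"
    for f :: "'n \<Rightarrow> 'x \<times> 'y \<Rightarrow> 'c::countable" and g :: "'n \<Rightarrow> 'x \<times> 'y \<Rightarrow> 'd::countable"
    using mutual_info_Pi_pmf[of p undefined f g] by (subst P) (simp add: mutual_info_map)
  have marginal: "mutual_info P (\<lambda>(x, y). x j) (\<lambda>(x, y). y j) = I j"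
    "cond_ent P (\<lambda>(x, y). x j) (\<lambda>(x, y). y j) = HX j - I j" for j
    unfolding cond_ent_eq_diff I_def HX_def p_def
    by (simp_all add: mutual_info_map case_prod_unfold)
  have I_restrict: "mutual_info P fst (\<lambda>(x, y). restrict y T) = (\<Sum>j\<in>T. I j)" for T
  proof -
    have "mutual_info P fst (\<lambda>(x, y). restrict y T) =
        (\<Sum>j\<in>UNIV. mutual_info (p j) fst (\<lambda>z. if j \<in> T then snd z else undefined))"
      using additive[of "\<lambda>j. fst" "\<lambda>j z. if j \<in> T then snd z else undefined"]
      by (simp add: restrict_eq_if case_prod_unfold cong: if_cong)
    also have "\<dots> = (\<Sum>j\<in>UNIV. if j \<in> T then I j else 0)"
      by (intro sum.cong refl) (simp add: I_def mutual_info_commute[of _ _ "\<lambda>_. undefined"])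
    finally show ?thesis by (simp add: sum.If_cases)
  qed
  have H_restrict: "mutual_info P (\<lambda>(x, y). restrict y T) (\<lambda>(x, y). restrict y T) = (\<Sum>j\<in>T. HY j)" for T
  proof -
    have "mutual_info P (\<lambda>(x, y). restrict y T) (\<lambda>(x, y). restrict y T) =
        (\<Sum>j\<in>UNIV. mutual_info (p j) (\<lambda>z. if j \<in> T then snd z else undefined)
          (\<lambda>z. if j \<in> T then snd z else undefined))"
      using additive[of "\<lambda>j z. if j \<in> T then snd z else undefined"
          "\<lambda>j z. if j \<in> T then snd z else undefined"]
      by (simp add: restrict_eq_if case_prod_unfold cong: if_cong)
    also have "\<dots> = (\<Sum>j\<in>UNIV. if j \<in> T then HY j else 0)"
      by (intro sum.cong refl) (simp add: HY_def)
    finally show ?thesis by (simp add: sum.If_cases)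
  qed
  \<comment> \<open>The mutual information cancels against the conditional entropies, leaving the
    entropies of the private letters.\<close>
  have Delta1: "Delta1 P T = (\<Sum>j\<in>T. HX j)" for T
    unfolding Delta1_def I_restrict marginal by (simp add: sum.distrib[symmetric])
  have Delta2: "Delta2 P T = (\<Sum>j\<in>T. I j + (ln (I j + 1) + 4))" for T
    unfolding Delta2_def I_restrict marginal by (simp add: sum.distrib)
  have "mutual_info P fst snd \<le> mutual_info P fst fst" by (rule mutual_info_le_self)
  also have "mutual_info P fst fst = (\<Sum>j\<in>UNIV. HX j)"
    using additive[of "\<lambda>j. fst" "\<lambda>j. fst"] by (simp add: HX_def)
  finally have "0 < (\<Sum>j\<in>UNIV. HX j)" "\<delta> \<le> (\<Sum>j\<in>UNIV. HX j)"
    using assms(3-5) by (auto simp: \<delta>_def)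
  moreover have "0 \<le> \<delta>" unfolding \<delta>_def by (rule mutual_info_nonneg)
  ultimately have \<alpha>: "0 \<le> \<alpha>" "\<alpha> \<le> 1" "\<alpha> * (\<Sum>j\<in>UNIV. HX j) = \<delta>"
    by (auto simp: \<alpha>_def)
  have "\<forall>j. \<exists>L :: (('x \<times> 'y) \<times> nat) pmf. finite (set_pmf L) \<and> map_pmf fst L = p j \<and>
    mutual_info L (\<lambda>z. fst (fst z)) snd = \<alpha> * HX j \<and>
    HY j - (I j + ln (I j + 1) + 4) \<le> mutual_info L (\<lambda>z. snd (fst z)) snd \<and>
    HY j - HX j \<le> mutual_info L (\<lambda>z. snd (fst z)) snd"
    unfolding HX_def HY_def I_def by (intro allI single_letter \<alpha>(1,2))
  from choice[OF this] obtain L :: "'n \<Rightarrow> (('x \<times> 'y) \<times> nat) pmf" where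
    fin: "\<And>j. finite (set_pmf (L j))" and
    fst_L: "\<And>j. map_pmf fst (L j) = p j" and
    leak: "\<And>j. mutual_info (L j) (\<lambda>z. fst (fst z)) snd = \<alpha> * HX j" and
    useful: "\<And>j. HY j - (I j + ln (I j + 1) + 4) \<le> mutual_info (L j) (\<lambda>z. snd (fst z)) snd"
      "\<And>j. HY j - HX j \<le> mutual_info (L j) (\<lambda>z. snd (fst z)) snd"
    by blast
  \<comment> \<open>Disintegrating every single-pair law and drawing the coordinates independently
    gives the conditional law of U* given (X, Y).\<close>
  define q where "q j a = map_pmf snd (cond_pmf (L j) (fst -` {a}))" for j a
  define Qs where "Qs z = Pi_pmf UNIV undefined (\<lambda>j. q j (fst z j, snd z j))" for z
  define R where "R = joint_law P Qs"
  define h where "h \<omega> = ((\<lambda>j. fst (fst (\<omega> j)), \<lambda>j. snd (fst (\<omega> j))), \<lambda>j. snd (\<omega> j))"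
    for \<omega> :: "'n \<Rightarrow> ('x \<times> 'y) \<times> nat"
  have L: "joint_law (p j) (q j) = L j" for j
    using joint_law_disintegration[of "L j"] by (simp add: fst_L q_def[abs_def])
  have pmf_L: "pmf (L j) (a, u) = pmf (p j) a * pmf (q j a) u" for j a u
    by (subst L[symmetric]) (rule pmf_joint_law)
  \<comment> \<open>The joint law is a regrouped product of the laws \<open>L j\<close>, so
    factorization and additivity apply to it.\<close>
  have R: "R = map_pmf h (Pi_pmf UNIV undefined L)"
  proof (rule pmf_eqI)
    fix z :: "(('n \<Rightarrow> 'x) \<times> ('n \<Rightarrow> 'y)) \<times> ('n \<Rightarrow> nat)"
    obtain x y u where z: "z = ((x, y), u)" by (metis surj_pair)
    define \<omega> where "\<omega> = (\<lambda>j. ((x j, y j), u j))"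
    have "inj h" by (auto simp: inj_def h_def fun_eq_iff prod_eq_iff)
    moreover have "z = h \<omega>" by (simp add: z h_def \<omega>_def)
    ultimately have "pmf (map_pmf h (Pi_pmf UNIV undefined L)) z = pmf (Pi_pmf UNIV undefined L) \<omega>"
      by (simp add: pmf_map_inj')
    also have "\<dots> = (\<Prod>j\<in>UNIV. pmf (p j) (x j, y j) * pmf (q j (x j, y j)) (u j))"
      by (subst pmf_Pi') (auto simp: \<omega>_def pmf_L)
    also have "\<dots> = pmf R z"
    proof -
      have "pmf P (x, y) = (\<Prod>j\<in>UNIV. pmf (p j) (x j, y j))"
        using assms(1) unfolding independent_pairs_def p_def by blast
      moreover have "pmf (Qs (x, y)) u = (\<Prod>j\<in>UNIV. pmf (q j (x j, y j)) (u j))"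
        unfolding Qs_def by (subst pmf_Pi') auto
      ultimately show ?thesis by (simp add: R_def z pmf_joint_law prod.distrib)
    qed
    finally show "pmf R z = pmf (map_pmf h (Pi_pmf UNIV undefined L)) z" ..
  qed
  have additive_R: "mutual_info R (\<lambda>z j. f j (fst (fst z) j, snd (fst z) j)) snd =
      (\<Sum>j\<in>UNIV. mutual_info (L j) (\<lambda>z. f j (fst z)) snd)"
    for f :: "'n \<Rightarrow> 'x \<times> 'y \<Rightarrow> 'c::countable"
    using mutual_info_Pi_pmf[where d = undefined and f = "\<lambda>j z. f j (fst z)" and g = "\<lambda>j. snd", OF fin]
    by (simp add: R mutual_info_map h_def)
  have "cond_factorizes R"
    unfolding R h_def by (rule cond_factorizes_Pi_pmf)
  moreover have "mutual_info R (\<lambda>((x, y), u). x) (\<lambda>((x, y), u). u) = \<delta>"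
    using additive_R[of "\<lambda>j. fst"] \<alpha>(3) by (simp add: case_prod_unfold leak sum_distrib_left)
  moreover have "mutual_info (joint_law P Q) (\<lambda>((x, y), u). restrict y T) (\<lambda>((x, y), u). u) \<le>
      mutual_info R (\<lambda>((x, y), u). restrict y T) (\<lambda>((x, y), u). u) + min (Delta1 P T) (Delta2 P T)" for T
  proof -
    \<comment> \<open>The utility of the given U is bounded by the entropy of the sub-vector alone;
      U itself enters only through \<open>\<delta>\<close>.\<close>
    have "mutual_info (joint_law P Q) (\<lambda>((x, y), u). restrict y T) (\<lambda>((x, y), u). u) \<le>
        mutual_info (joint_law P Q) (\<lambda>((x, y), u). restrict y T) (\<lambda>((x, y), u). restrict y T)"
      by (rule mutual_info_le_self)
    also have "\<dots> = mutual_info (map_pmf fst (joint_law P Q)) (\<lambda>(x, y). restrict y T) (\<lambda>(x, y). restrict y T)"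
      unfolding mutual_info_map by (simp add: case_prod_unfold)
    also have "\<dots> = (\<Sum>j\<in>T. HY j)" by (simp add: H_restrict)
    finally have upper: "mutual_info (joint_law P Q) (\<lambda>((x, y), u). restrict y T) (\<lambda>((x, y), u). u) \<le> (\<Sum>j\<in>T. HY j)" .
    have "mutual_info R (\<lambda>((x, y), u). restrict y T) (\<lambda>((x, y), u). u) =
        (\<Sum>j\<in>UNIV. mutual_info (L j) (\<lambda>z. if j \<in> T then snd (fst z) else undefined) snd)"
      using additive_R[of "\<lambda>j z. if j \<in> T then snd z else undefined"]
      by (simp add: restrict_eq_if case_prod_unfold cong: if_cong)
    also have "\<dots> = (\<Sum>j\<in>UNIV. if j \<in> T then mutual_info (L j) (\<lambda>z. snd (fst z)) snd else 0)"
      by (intro sum.cong refl) simp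
    finally have eq: "mutual_info R (\<lambda>((x, y), u). restrict y T) (\<lambda>((x, y), u). u) =
        (\<Sum>j\<in>T. mutual_info (L j) (\<lambda>z. snd (fst z)) snd)"
      by (simp add: sum.If_cases)
    \<comment> \<open>Both bounds hold for the same mechanism, so the losses summed over
      \<open>T\<close> give the minimum of the two totals.\<close>
    have "(\<Sum>j\<in>T. HY j - HX j) \<le> (\<Sum>j\<in>T. mutual_info (L j) (\<lambda>z. snd (fst z)) snd)"
      "(\<Sum>j\<in>T. HY j - (I j + ln (I j + 1) + 4)) \<le> (\<Sum>j\<in>T. mutual_info (L j) (\<lambda>z. snd (fst z)) snd)"
      by (intro sum_mono useful)+
    then show ?thesis
      using upper unfolding eq Delta1 Delta2 by (simp add: sum_subtractf add.assoc min_def)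
  qed
  ultimately show ?thesis
    unfolding R_def \<delta>_def[symmetric]
    by (intro conjI exI[of _ Qs] ballI) (auto simp: Delta1 Delta2 marginal)
qed

thm_deps theorem1

end
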